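(* The integrality gap of the Bidirected Cut Relaxation for Steiner Tree restricted to MST-optimal instances is at most $\frac{12}{7}$; that is, for every MST-optimal instance $\mathcal{I}$ of the Steiner Tree problem, $\mathrm{OPT}(\mathcal{I}) \le \frac{12}{7}\cdot \mathrm{BCR}(\mathcal{I})$.
   Context: An instance $\mathcal{I}=(G,c,R)$ of the Steiner Tree problem consists of a finite connected undirected graph $G=(V,E)$, positive edge costs $c\colon E\to\mathbb{R}_{>0}$, and a nonempty set $R\subseteq V$ of terminals. A Steiner tree is a tree in $G$ containing all terminals; $\mathrm{OPT}(\mathcal{I})$ is the minimum cost of a Steiner tree. Let $\mathrm{dist}(x,y)$ be the length of a shortest $x$-$y$ path in $(G,c)$. $\mathrm{TMST}$ is the cost of a terminal MST, i.e. of a minimum spanning tree of the complete graph on $R$ with edge costs $\mathrm{dist}(x,y)$. The instance is MST-optimal if $\mathrm{TMST}=\mathrm{OPT}$. Bidirected Cut Relaxation: replace every undirected edge $\{u,v\}$ by the two directed edges $(u,v),(v,u)$, each of cost $c(\{u,v\})$; let $\vec E$ be the resulting edge set. Fix an arbitrary root $r\in R$. For $S\subseteq V$ let $\delta^+(S)=\{(v,w)\in\vec E: v\in S, w\notin S\}$. Then $\mathrm{BCR}(\mathcal{I})$ is the optimum value of the linear program $$\min \sum_{e\in\vec E}c(e)x_e\quad\text{s.t.}\quad \sum_{e\in\delta^+(S)}x_e\ge 1\ \ \forall S\subseteq V\setminus\{r\}\text{ with }S\cap R\ne\emptyset,\qquad x_e\ge 0\ \ \forall e\in\vec E.$$ This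 value is independent of the choice of $r\in R$. *)

theory Defs
  imports Complex_Main
begin

section \<open>Finite simple undirected graphs\<close>

text \<open>A graph is given by a vertex set \<open>V\<close> and a set \<open>E\<close> of two-element edges. The digraph
  library's notion of tree is not used, because in a symmetric digraph \<open>u, v, u\<close> is a cycle.\<close>

definition ugraph :: "'a set \<Rightarrow> 'a set set \<Rightarrow> bool" where
  "ugraph V E \<longleftrightarrow> finite V \<and> (\<forall>e\<in>E. e \<subseteq> V \<and> card e = 2)"

definition usubgraph :: "'a set \<Rightarrow> 'a set set \<Rightarrow> 'a set \<Rightarrow> 'a set set \<Rightarrow> bool" where
  "usubgraph W F V E \<longleftrightarrow> ugraph W F \<and> W \<subseteq> V \<and> F \<subseteq> E"

text \<open>Walks and paths are nonempty vertex sequences; \<open>[u]\<close> is the trivial path at \<open>u\<close>.\<close>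

definition uwalk :: "'a set \<Rightarrow> 'a set set \<Rightarrow> 'a \<Rightarrow> 'a list \<Rightarrow> 'a \<Rightarrow> bool" where
  "uwalk V E u p v \<longleftrightarrow> p \<noteq> [] \<and> hd p = u \<and> last p = v \<and> set p \<subseteq> V \<and>
     successively (\<lambda>x y. {x, y} \<in> E) p"

definition upath :: "'a set \<Rightarrow> 'a set set \<Rightarrow> 'a \<Rightarrow> 'a list \<Rightarrow> 'a \<Rightarrow> bool" where
  "upath V E u p v \<longleftrightarrow> uwalk V E u p v \<and> distinct p"

definition ucycle :: "'a set \<Rightarrow> 'a set set \<Rightarrow> 'a list \<Rightarrow> bool" where
  "ucycle V E p \<longleftrightarrow> 3 \<le> length p \<and> upath V E (hd p) p (last p) \<and> {last p, hd p} \<in> E"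

definition uconnected :: "'a set \<Rightarrow> 'a set set \<Rightarrow> bool" where
  "uconnected V E \<longleftrightarrow> V \<noteq> {} \<and> (\<forall>u\<in>V. \<forall>v\<in>V. \<exists>p. uwalk V E u p v)"

definition utree :: "'a set \<Rightarrow> 'a set set \<Rightarrow> bool" where
  "utree V E \<longleftrightarrow> ugraph V E \<and> uconnected V E \<and> \<not> (\<exists>p. ucycle V E p)"

definition mst_cost :: "'a set \<Rightarrow> 'a set set \<Rightarrow> ('a set \<Rightarrow> real) \<Rightarrow> real" where
  "mst_cost V E w = Min {sum w F | F. usubgraph V F V E \<and> utree V F}"

section \<open>The Steiner tree problem\<close>

definition steiner_instance :: "'a set \<Rightarrow> 'a set set \<Rightarrow> ('a set \<Rightarrow> real) \<Rightarrow> 'a set \<Rightarrow> bool" where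
  "steiner_instance V E c R \<longleftrightarrow>
     ugraph V E \<and> uconnected V E \<and> (\<forall>e\<in>E. 0 < c e) \<and> R \<subseteq> V \<and> R \<noteq> {}"

definition steiner_tree :: "'a set \<Rightarrow> 'a set set \<Rightarrow> 'a set \<Rightarrow> 'a set \<Rightarrow> 'a set set \<Rightarrow> bool" where
  "steiner_tree V E R W F \<longleftrightarrow> usubgraph W F V E \<and> utree W F \<and> R \<subseteq> W"

definition OPT :: "'a set \<Rightarrow> 'a set set \<Rightarrow> ('a set \<Rightarrow> real) \<Rightarrow> 'a set \<Rightarrow> real" where
  "OPT V E c R = Min {sum c F | W F. steiner_tree V E R W F}"

definition path_length :: "('a set \<Rightarrow> real) \<Rightarrow> 'a list \<Rightarrow> real" where
  "path_length c p = (\<Sum>(x, y)\<leftarrow>zip p (tl p). c {x, y})"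

definition sp_dist :: "'a set \<Rightarrow> 'a set set \<Rightarrow> ('a set \<Rightarrow> real) \<Rightarrow> 'a \<Rightarrow> 'a \<Rightarrow> real" where
  "sp_dist V E c x y = Min {path_length c p | p. upath V E x p y}"

definition complete_edges :: "'a set \<Rightarrow> 'a set set" where
  "complete_edges R = {{x, y} | x y. x \<in> R \<and> y \<in> R \<and> x \<noteq> y}"

text \<open>The distance as a cost on unordered pairs; the description is well defined because
  distances are symmetric, see \<open>dist_cost_pair\<close> below.\<close>

definition dist_cost :: "'a set \<Rightarrow> 'a set set \<Rightarrow> ('a set \<Rightarrow> real) \<Rightarrow> 'a set \<Rightarrow> real" where
  "dist_cost V E c e = (THE d. \<exists>x y. e = {x, y} \<and> d = sp_dist V E c x y)"

definition TMST :: "'a set \<Rightarrow> 'a set set \<Rightarrow> ('a set \<Rightarrow> real) \<Rightarrow> 'a set \<Rightarrow> real" where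
  "TMST V E c R = mst_cost R (complete_edges R) (dist_cost V E c)"

definition MST_optimal :: "'a set \<Rightarrow> 'a set set \<Rightarrow> ('a set \<Rightarrow> real) \<Rightarrow> 'a set \<Rightarrow> bool" where
  "MST_optimal V E c R \<longleftrightarrow> TMST V E c R = OPT V E c R"

section \<open>The bidirected cut relaxation\<close>

definition bidirected :: "'a set set \<Rightarrow> ('a \<times> 'a) set" where
  "bidirected E = {(u, v). {u, v} \<in> E}"

definition out_cut :: "'a set set \<Rightarrow> 'a set \<Rightarrow> ('a \<times> 'a) set" where
  "out_cut E S = {(v, w) \<in> bidirected E. v \<in> S \<and> w \<notin> S}"

definition BCR_feasible ::
  "'a set \<Rightarrow> 'a set set \<Rightarrow> 'a set \<Rightarrow> 'a \<Rightarrow> ('a \<times> 'a \<Rightarrow> real) \<Rightarrow> bool" where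
  "BCR_feasible V E R r x \<longleftrightarrow>
     (\<forall>S. S \<subseteq> V - {r} \<and> S \<inter> R \<noteq> {} \<longrightarrow> 1 \<le> (\<Sum>a\<in>out_cut E S. x a)) \<and>
     (\<forall>a\<in>bidirected E. 0 \<le> x a)"

definition BCR_cost :: "'a set set \<Rightarrow> ('a set \<Rightarrow> real) \<Rightarrow> ('a \<times> 'a \<Rightarrow> real) \<Rightarrow> real" where
  "BCR_cost E c x = (\<Sum>(u, v)\<in>bidirected E. c {u, v} * x (u, v))"

definition BCR :: "'a set \<Rightarrow> 'a set set \<Rightarrow> ('a set \<Rightarrow> real) \<Rightarrow> 'a set \<Rightarrow> 'a \<Rightarrow> real" where
  "BCR V E c R r = Inf {BCR_cost E c x | x. BCR_feasible V E R r x}"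

section \<open>Well-definedness\<close>

text \<open>None of the minima and infima above is taken over an empty, infinite or (for \<open>BCR\<close>)
  unbounded set when the instance is legal.\<close>

lemma uwalk_rev: "uwalk V E x p y \<Longrightarrow> uwalk V E y (rev p) x"
proof -
  have "successively (\<lambda>x y. {y, x} \<in> E) p" if "successively (\<lambda>x y. {x, y} \<in> E) p"
    using that by (rule successively_mono) (metis insert_commute)
  then show "uwalk V E x p y \<Longrightarrow> uwalk V E y (rev p) x"
    by (simp add: uwalk_def hd_rev last_rev)
qed

lemma path_length_Cons:
  "p \<noteq> [] \<Longrightarrow> path_length c (x # p) = c {x, hd p} + path_length c p"
  by (cases p) (simp_all add: path_length_def)

lemma path_length_snoc:
  "p \<noteq> [] \<Longrightarrow> path_length c (p @ [x]) = path_length c p + c {last p, x}"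
proof (induction p)
  case (Cons a p)
  show ?case
  proof (cases "p = []")
    case True
    then show ?thesis by (simp add: path_length_def)
  next
    case False
    with Cons.IH show ?thesis by (simp add: path_length_Cons)
  qed
qed simp

lemma path_length_rev: "path_length c (rev p) = path_length c p"
proof (induction p)
  case (Cons a p)
  show ?case
  proof (cases "p = []")
    case False
    moreover have "{hd p, a} = {a, hd p}" by blast
    ultimately show ?thesis
      using Cons.IH by (simp add: path_length_Cons path_length_snoc last_rev)
  qed simp
qed simp

lemma sp_dist_sym: "sp_dist V E c x y = sp_dist V E c y x"
proof -
  have "{path_length c p | p. upath V E x p y} \<subseteq> {path_length c p | p. upath V E y p x}" for x y
  proof clarify
    fix p assume "upath V E x p y"
    then have "upath V E y (rev p) x"
      by (simp add: upath_def uwalk_rev)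
    then show "\<exists>q. path_length c p = path_length c q \<and> upath V E y q x"
      by (metis path_length_rev)
  qed
  then show ?thesis
    unfolding sp_dist_def by (intro arg_cong[where f = Min] subset_antisym)
qed

lemma dist_cost_pair: "dist_cost V E c {x, y} = sp_dist V E c x y"
  unfolding dist_cost_def
proof (rule the_equality)
  fix d assume "\<exists>x' y'. {x, y} = {x', y'} \<and> d = sp_dist V E c x' y'"
  then show "d = sp_dist V E c x y"
    by (metis doubleton_eq_iff sp_dist_sym)
qed blast

lemma finite_edges: "ugraph V E \<Longrightarrow> finite E"
  by (rule finite_subset[of _ "Pow V"]) (auto simp: ugraph_def)

lemma bidirected_subset: "ugraph V E \<Longrightarrow> bidirected E \<subseteq> V \<times> V"
  by (auto simp: ugraph_def bidirected_def)

lemma ugraph_complete: "finite R \<Longrightarrow> ugraph R (complete_edges R)"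
  by (auto simp: ugraph_def complete_edges_def)

lemma uwalk_rtrancl: "uwalk V E u p v \<Longrightarrow> (u, v) \<in> (bidirected E)\<^sup>*"
proof (induction p arbitrary: u)
  case (Cons a p)
  show ?case
  proof (cases "p = []")
    case True
    with Cons.prems have "u = v" by (auto simp: uwalk_def)
    then show ?thesis by simp
  next
    case False
    with Cons.prems have "(u, hd p) \<in> bidirected E" "uwalk V E (hd p) p v"
      by (auto simp: uwalk_def successively_Cons bidirected_def)
    then show ?thesis
      using Cons.IH by (blast intro: converse_rtrancl_into_rtrancl)
  qed
qed (simp add: uwalk_def)

lemma rtrancl_upath:
  assumes "ugraph V E" "u \<in> V" "(u, v) \<in> (bidirected E)\<^sup>*"
  shows "\<exists>p. upath V E u p v"
  using assms(3)
proof (induction rule: rtrancl_induct)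
  case base
  from assms(2) have "upath V E u [u] u" by (simp add: upath_def uwalk_def)
  then show ?case ..
next
  case (step v w)
  then obtain p where p: "upath V E u p v" by blast
  have w: "w \<in> V" "{v, w} \<in> E"
    using step.hyps(2) bidirected_subset[OF assms(1)] by (auto simp: bidirected_def)
  show ?case
  proof (cases "w \<in> set p")
    case True
    then obtain a b where ab: "p = a @ w # b" by (meson split_list)
    have "hd (a @ [w]) = hd p" by (cases a) (simp_all add: ab)
    with p have "upath V E u (a @ [w]) w"
      by (simp add: ab upath_def uwalk_def successively_append_iff)
    then show ?thesis ..
  next
    case False
    with p w have "upath V E u (p @ [w]) w"
      by (simp add: upath_def uwalk_def successively_append_iff)
    then show ?thesis ..
  qed
qed

lemma uconnected_iff:
  assumes "ugraph V E"
  shows "uconnected V E \<longleftrightarrow> V \<noteq> {} \<and> V \<times> V \<subseteq> (bidirected E)\<^sup>*"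
proof -
  have "(\<exists>p. uwalk V E u p v) \<longleftrightarrow> (u, v) \<in> (bidirected E)\<^sup>*" if "u \<in> V" for u v
    using rtrancl_upath[OF assms that] uwalk_rtrancl by (metis upath_def)
  then show ?thesis by (auto simp: uconnected_def)
qed

lemma ucycle_remove_edge:
  assumes "ucycle V E p"
  shows "uwalk V (E - {{last p, hd p}}) (hd p) p (last p)"
proof -
  obtain x q where p: "p = x # q" using assms by (cases p) (auto simp: ucycle_def)
  have q: "2 \<le> length q" "distinct q" "x \<notin> set q" "{x, hd q} \<in> E" "set p \<subseteq> V"
      "successively (\<lambda>x y. {x, y} \<in> E) q"
    using assms by (auto simp: p ucycle_def upath_def uwalk_def successively_Cons)
  from q(1) have "q \<noteq> []" by auto
  obtain y q' where "q = y # q'" "q' \<noteq> []" using q(1) by (cases q) (auto simp: Suc_le_eq)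
  with q(2) have "hd q \<noteq> last q" by auto
  then have "{x, hd q} \<noteq> {last p, x}"
    using \<open>q \<noteq> []\<close> by (auto simp: p doubleton_eq_iff)
  moreover have "successively (\<lambda>a b. {a, b} \<in> E - {{last p, x}}) q"
    using q(6)
  proof (rule successively_mono)
    fix a b assume "a \<in> set q" "b \<in> set q" "{a, b} \<in> E"
    with q(3) show "{a, b} \<in> E - {{last p, x}}" by (auto simp: doubleton_eq_iff)
  qed
  ultimately show ?thesis
    using q(4,5) \<open>q \<noteq> []\<close> by (simp add: p uwalk_def successively_Cons)
qed

lemma spanning_tree_exists:
  assumes "ugraph V E" "uconnected V E"
  shows "\<exists>F. usubgraph V F V E \<and> utree V F"
proof -
  let ?P = "\<lambda>F. F \<subseteq> E \<and> uconnected V F"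
  define F where "F = arg_min card ?P"
  have F: "?P F" unfolding F_def by (rule arg_min_natI[of ?P E]) (use assms in auto)
  have min: "card F \<le> card F'" if "?P F'" for F'
    unfolding F_def by (rule arg_min_nat_le) (rule that)
  have gr: "ugraph V F'" if "F' \<subseteq> E" for F' using assms(1) that by (auto simp: ugraph_def)
  have "\<not> ucycle V F p" for p
  proof
    assume cyc: "ucycle V F p"
    let ?e = "{last p, hd p}" and ?F = "F - {{last p, hd p}}"
    have e: "?e \<in> F" using cyc by (simp add: ucycle_def)
    have *: "(hd p, last p) \<in> (bidirected ?F)\<^sup>*"
      using uwalk_rtrancl[OF ucycle_remove_edge[OF cyc]] .
    have **: "(last p, hd p) \<in> (bidirected ?F)\<^sup>*"
      using uwalk_rtrancl[OF uwalk_rev[OF ucycle_remove_edge[OF cyc]]] .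
    have "bidirected F \<subseteq> (bidirected ?F)\<^sup>*"
    proof clarify
      fix a b assume ab: "(a, b) \<in> bidirected F"
      show "(a, b) \<in> (bidirected ?F)\<^sup>*"
      proof (cases "{a, b} = ?e")
        case True
        with * ** show ?thesis by (auto simp: doubleton_eq_iff)
      next
        case False
        with ab have "(a, b) \<in> bidirected ?F" by (simp add: bidirected_def)
        then show ?thesis by blast
      qed
    qed
    then have "(bidirected F)\<^sup>* \<subseteq> (bidirected ?F)\<^sup>*" by (rule rtrancl_subset_rtrancl)
    moreover have "V \<noteq> {} \<and> V \<times> V \<subseteq> (bidirected F)\<^sup>*"
      using F uconnected_iff[OF gr] by blast
    ultimately have "uconnected V ?F"
      using F by (subst uconnected_iff[OF gr]) auto
    then have "card F \<le> card ?F" using F by (intro min) auto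
    moreover have "finite F" using F finite_edges[OF assms(1)] finite_subset by blast
    ultimately show False using card_Diff1_less[OF _ e] by simp
  qed
  with F gr show ?thesis by (auto simp: usubgraph_def utree_def)
qed

lemma OPT_set:
  assumes "steiner_instance V E c R"
  shows "finite {sum c F | W F. steiner_tree V E R W F}"
    and "{sum c F | W F. steiner_tree V E R W F} \<noteq> {}"
proof -
  have g: "ugraph V E" "uconnected V E" "R \<subseteq> V"
    using assms by (auto simp: steiner_instance_def)
  show "finite {sum c F | W F. steiner_tree V E R W F}"
  proof (rule finite_subset)
    show "{sum c F | W F. steiner_tree V E R W F} \<subseteq> sum c ` Pow E"
      by (auto simp: steiner_tree_def usubgraph_def)
    show "finite (sum c ` Pow E)" using finite_edges[OF g(1)] by simp
  qed
  show "{sum c F | W F. steiner_tree V E R W F} \<noteq> {}"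
    using spanning_tree_exists[OF g(1,2)] g(3) by (auto simp: steiner_tree_def)
qed

lemma sp_dist_set:
  assumes "steiner_instance V E c R" "x \<in> V" "y \<in> V"
  shows "finite {path_length c p | p. upath V E x p y}"
    and "{path_length c p | p. upath V E x p y} \<noteq> {}"
proof -
  have g: "ugraph V E" "uconnected V E"
    using assms by (auto simp: steiner_instance_def)
  show "finite {path_length c p | p. upath V E x p y}"
  proof (rule finite_subset)
    show "{path_length c p | p. upath V E x p y}
        \<subseteq> path_length c ` {p. set p \<subseteq> V \<and> length p \<le> card V}"
    proof clarify
      fix p assume "upath V E x p y"
      then have "set p \<subseteq> V" "distinct p" by (simp_all add: upath_def uwalk_def)
      then have "length p \<le> card V"
        using g(1) by (metis card_mono distinct_card ugraph_def)
      with \<open>set p \<subseteq> V\<close>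
      show "path_length c p \<in> path_length c ` {p. set p \<subseteq> V \<and> length p \<le> card V}" by blast
    qed
    show "finite (path_length c ` {p. set p \<subseteq> V \<and> length p \<le> card V})"
      using g(1) by (intro finite_imageI finite_lists_length_le) (simp add: ugraph_def)
  qed
  have "(x, y) \<in> (bidirected E)\<^sup>*"
    using g assms(2,3) uconnected_iff by blast
  then show "{path_length c p | p. upath V E x p y} \<noteq> {}"
    using rtrancl_upath[OF g(1) assms(2)] by blast
qed

lemma TMST_set:
  fixes w :: "'a set \<Rightarrow> real"
  assumes "steiner_instance V E c R"
  shows "finite {sum w F | F. usubgraph R F R (complete_edges R) \<and> utree R F}"
    and "{sum w F | F. usubgraph R F R (complete_edges R) \<and> utree R F} \<noteq> {}"
proof -
  have R: "finite R" "R \<noteq> {}"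
    using assms by (auto simp: steiner_instance_def ugraph_def intro: finite_subset)
  note g = ugraph_complete[OF R(1)]
  show "finite {sum w F | F. usubgraph R F R (complete_edges R) \<and> utree R F}"
  proof (rule finite_subset)
    show "{sum w F | F. usubgraph R F R (complete_edges R) \<and> utree R F}
        \<subseteq> sum w ` Pow (complete_edges R)"
      by (auto simp: usubgraph_def)
    show "finite (sum w ` Pow (complete_edges R))" using finite_edges[OF g] by simp
  qed
  have "(x, y) \<in> (bidirected (complete_edges R))\<^sup>*" if "x \<in> R" "y \<in> R" for x y
  proof (cases "x = y")
    case False
    with that have "(x, y) \<in> bidirected (complete_edges R)"
      by (auto simp: bidirected_def complete_edges_def)
    then show ?thesis by blast
  qed simp
  then have "uconnected R (complete_edges R)"
    using R(2) by (subst uconnected_iff[OF g]) auto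
  from spanning_tree_exists[OF g this]
  show "{sum w F | F. usubgraph R F R (complete_edges R) \<and> utree R F} \<noteq> {}" by blast
qed

lemma BCR_set:
  assumes "steiner_instance V E c R" "r \<in> R"
  shows "bdd_below {BCR_cost E c x | x. BCR_feasible V E R r x}"
    and "{BCR_cost E c x | x. BCR_feasible V E R r x} \<noteq> {}"
proof -
  have g: "ugraph V E" "uconnected V E" "r \<in> V" "\<And>e. e \<in> E \<Longrightarrow> 0 < c e"
    using assms by (auto simp: steiner_instance_def)
  have fin: "finite (bidirected E)"
    using finite_subset[OF bidirected_subset[OF g(1)]] g(1) by (simp add: ugraph_def)
  have "0 \<le> BCR_cost E c x" if "BCR_feasible V E R r x" for x
    unfolding BCR_cost_def
  proof (rule sum_nonneg)
    fix a assume a: "a \<in> bidirected E"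
    with that have "0 \<le> x a" by (simp add: BCR_feasible_def)
    with a g(4) show "0 \<le> (case a of (u, v) \<Rightarrow> c {u, v} * x (u, v))"
      by (auto simp: bidirected_def less_imp_le)
  qed
  then show "bdd_below {BCR_cost E c x | x. BCR_feasible V E R r x}"
    by (intro bdd_belowI[of _ 0]) auto
  have "1 \<le> (\<Sum>a\<in>out_cut E S. 1 :: real)" if S: "S \<subseteq> V - {r}" "S \<inter> R \<noteq> {}" for S
  proof -
    obtain s where s: "s \<in> S" using S(2) by blast
    have "(s, r) \<in> (bidirected E)\<^sup>*"
      using s S(1) g(2,3) uconnected_iff[OF g(1)] by blast
    moreover have "(s, v) \<in> (bidirected E)\<^sup>* \<Longrightarrow> out_cut E S = {} \<Longrightarrow> v \<in> S" for v
      by (induction rule: rtrancl_induct) (use s in \<open>auto simp: out_cut_def\<close>)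
    ultimately have "out_cut E S \<noteq> {}" using S(1) by blast
    moreover have "finite (out_cut E S)"
      by (rule finite_subset[OF _ fin]) (auto simp: out_cut_def)
    ultimately have "1 \<le> card (out_cut E S)" by (simp add: Suc_le_eq card_gt_0_iff)
    then show ?thesis by simp
  qed
  then have "BCR_feasible V E R r (\<lambda>_. 1)" by (simp add: BCR_feasible_def)
  then show "{BCR_cost E c x | x. BCR_feasible V E R r x} \<noteq> {}" by blast
qed

end

theory Submission
  imports Defs
begin

text \<open>
  Let \<open>opt Z\<close> be the minimum cost of an edge set connecting \<open>Z\<close>. A dual solution is grown
  for \<open>BCR\<close>: starting from single terminals, every component of terminals keeps a set of vertices
  it has reached, all components load the arcs leaving their sets at unit rate, and a fully loaded
  arc passes the components at its tail on to its head. Two components at distance \<open>d\<close> are merged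
  at time \<open>d / D\<close>, so the total dual value is \<open>opt R / D\<close>. It is a feasible dual as long as no
  component reaches a terminal of another one.

  Loads pay for trees: a vertex reached by one component at time \<open>t\<close> can be connected to it at
  cost \<open>t\<close>, and if two components \<open>A\<close>, \<open>B\<close> share a vertex, a free ride on the loads of \<open>A\<close> costs
  \<open>B\<close> at most \<open>3 * t - D * t\<close>, while a tree joining \<open>A\<close>, \<open>B\<close> and the vertex has excess at most
  \<open>3 * t - D * t / 2\<close>. If three components met in a vertex, these trees would beat the terminal
  spanning tree, whose corresponding links cost at least \<open>2 * D * t\<close>, precisely if
  \<open>D > 12 / 7\<close>. Hence every vertex is reached by at most two components in the whole process.
  The bound follows with \<open>D\<close> tending to \<open>12 / 7\<close>.
\<close>

section \<open>Terminal spanning trees and optimal connections\<close>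

definition connects :: "'a set set \<Rightarrow> 'a set \<Rightarrow> bool" where
  "connects F Z \<longleftrightarrow> Z \<times> Z \<subseteq> (bidirected F)\<^sup>*"

text \<open>Arbitrary connecting edge sets instead of trees: unions of overlapping ones connect
  again without any removal of cycles, and \<open>OPT_le_opt\<close> recovers a Steiner
  tree.\<close>

definition conn_cost :: "'a set set \<Rightarrow> ('a set \<Rightarrow> real) \<Rightarrow> 'a set \<Rightarrow> real" where
  "conn_cost E c Z = Min (sum c ` {F. F \<subseteq> E \<and> connects F Z})"

lemma bidirected_mono: "F \<subseteq> G \<Longrightarrow> bidirected F \<subseteq> bidirected G"
  by (auto simp: bidirected_def)

lemma sym_bidirected: "sym (bidirected F)"
  by (auto simp: bidirected_def insert_commute intro: symI)

lemma connects_mono: "connects F Z \<Longrightarrow> F \<subseteq> G \<Longrightarrow> W \<subseteq> Z \<Longrightarrow> connects G W"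
  unfolding connects_def using rtrancl_mono[OF bidirected_mono] by blast

lemma connects_Un:
  assumes "connects F X" "connects F Y" "X \<inter> Y \<noteq> {}"
  shows "connects F (X \<union> Y)"
proof -
  obtain z where z: "z \<in> X" "z \<in> Y" using assms(3) by blast
  have "(x, z) \<in> (bidirected F)\<^sup>*" "(z, x) \<in> (bidirected F)\<^sup>*" if "x \<in> X \<union> Y" for x
    using that assms(1,2) z by (auto simp: connects_def)
  then show ?thesis unfolding connects_def by (blast intro: rtrancl_trans)
qed

lemma connects_edge: "e \<in> F \<Longrightarrow> card e = 2 \<Longrightarrow> connects F e"
  by (auto simp: connects_def card_2_iff bidirected_def insert_commute)

lemma upath_connects:
  assumes "upath V E x p y"
  shows "\<exists>F\<subseteq>E. connects F {x, y} \<and> ((\<forall>e\<in>E. 0 < c e) \<longrightarrow> sum c F \<le> path_length c p)"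
proof -
  \<comment> \<open>In a vertex sequence without \<open>distinct\<close> an edge may recur; it
    enters \<open>F\<close> once but the length each time, hence the inequality.\<close>
  have "\<exists>F\<subseteq>E. finite F \<and> (hd p, last p) \<in> (bidirected F)\<^sup>* \<and>
      ((\<forall>e\<in>E. 0 < c e) \<longrightarrow> sum c F \<le> path_length c p)"
    if "p \<noteq> []" "successively (\<lambda>x y. {x, y} \<in> E) p"
    using that
  proof (induction p rule: list_nonempty_induct)
    case (single x)
    then show ?case by (intro exI[of _ "{}"]) (simp add: path_length_def)
  next
    case (cons x p)
    then obtain F where F: "F \<subseteq> E" "finite F" "(hd p, last p) \<in> (bidirected F)\<^sup>*"
      "(\<forall>e\<in>E. 0 < c e) \<longrightarrow> sum c F \<le> path_length c p" and e: "{x, hd p} \<in> E"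
      by (auto simp: successively_Cons)
    let ?F = "insert {x, hd p} F"
    have "(x, hd p) \<in> bidirected ?F" by (simp add: bidirected_def)
    moreover have "(hd p, last p) \<in> (bidirected ?F)\<^sup>*"
      using F(3) rtrancl_mono[OF bidirected_mono[of F ?F]] by blast
    ultimately have "(x, last p) \<in> (bidirected ?F)\<^sup>*"
      by (rule converse_rtrancl_into_rtrancl)
    moreover have "sum c ?F \<le> path_length c (x # p)" if "\<forall>e\<in>E. 0 < c e"
      using F that e cons.hyps by (auto simp: path_length_Cons sum.insert_if less_imp_le add_increasing)
    ultimately show ?case
      using F(1,2) e cons.hyps by (intro exI[of _ ?F]) simp
  qed
  with assms obtain F where F: "F \<subseteq> E" "(x, y) \<in> (bidirected F)\<^sup>*"
    "(\<forall>e\<in>E. 0 < c e) \<longrightarrow> sum c F \<le> path_length c p"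
    unfolding upath_def uwalk_def by blast
  have "(y, x) \<in> (bidirected F)\<^sup>*"
    using F(2) by (meson sym_bidirected sym_rtrancl symD)
  with F show ?thesis by (intro exI[of _ F]) (auto simp: connects_def)
qed

text \<open>The walk is read from its end back to \<open>a\<close>: either the part read so far
  avoids \<open>A\<close>, or the last step out of \<open>A\<close> has been seen.\<close>

lemma rtrancl_last_departure:
  assumes "(a, b) \<in> r\<^sup>*" "a \<in> A" "b \<notin> A"
  shows "\<exists>x y. x \<in> A \<and> y \<notin> A \<and> (x, y) \<in> r \<and> (y, b) \<in> (r \<inter> (- A) \<times> (- A))\<^sup>*"
proof -
  let ?r = "r \<inter> (- A) \<times> (- A)"
  have "a \<notin> A \<and> (a, b) \<in> ?r\<^sup>* \<or> (\<exists>x y. x \<in> A \<and> y \<notin> A \<and> (x, y) \<in> r \<and> (y, b) \<in> ?r\<^sup>*)"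
    using assms(1)
  proof (induction rule: converse_rtrancl_induct)
    case base
    then show ?case using assms(3) by blast
  next
    case (step u v)
    then show ?case
      by (cases "u \<in> A") (blast intro: converse_rtrancl_into_rtrancl)+
  qed
  with assms(2) show ?thesis by blast
qed


lemma rtrancl_subset_connects:
  assumes "X \<times> X \<subseteq> r\<^sup>*" "r \<subseteq> s\<^sup>*"
  shows "X \<times> X \<subseteq> s\<^sup>*"
  using assms rtrancl_subset_rtrancl by blast

section \<open>The minimum cost of connecting a vertex set\<close>

locale steiner =
  fixes V :: "'a set" and E :: "'a set set" and c :: "'a set \<Rightarrow> real" and R :: "'a set"
  assumes inst: "steiner_instance V E c R"
begin

lemma graph: "ugraph V E" "uconnected V E" "finite V" "finite E" "R \<subseteq> V" "R \<noteq> {}" "finite R"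
  and c_pos: "e \<in> E \<Longrightarrow> 0 < c e"
proof -
  show "ugraph V E" "uconnected V E" "R \<subseteq> V" "R \<noteq> {}" "finite V" "e \<in> E \<Longrightarrow> 0 < c e"
    using inst by (auto simp: steiner_instance_def ugraph_def)
  then show "finite E" "finite R" by (auto intro: finite_edges finite_subset)
qed

lemma edge_in_V: "{u, v} \<in> E \<Longrightarrow> u \<in> V" "{u, v} \<in> E \<Longrightarrow> v \<in> V"
  using graph(1) by (auto simp: ugraph_def)

lemma edge_card: "e \<in> E \<Longrightarrow> card e = 2"
  using graph(1) by (auto simp: ugraph_def)

definition opt :: "'a set \<Rightarrow> real" where "opt = conn_cost E c"

lemma connects_E: "Z \<subseteq> V \<Longrightarrow> connects E Z"
  using graph(1,2) uconnected_iff unfolding connects_def by blast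

lemma opt_le: "F \<subseteq> E \<Longrightarrow> connects F Z \<Longrightarrow> opt Z \<le> sum c F"
  unfolding opt_def conn_cost_def using graph(4) by (intro Min_le) auto

lemma opt_obtain:
  assumes "Z \<subseteq> V"
  obtains F where "F \<subseteq> E" "connects F Z" "sum c F = opt Z"
proof -
  have "opt Z \<in> sum c ` {F. F \<subseteq> E \<and> connects F Z}"
    unfolding opt_def conn_cost_def
    using graph(4) connects_E[OF assms] by (intro Min_in) auto
  then show thesis using that by auto
qed

lemma sum_c_mono: "F \<subseteq> G \<Longrightarrow> G \<subseteq> E \<Longrightarrow> sum c F \<le> sum c G"
  using graph(4) c_pos by (intro sum_mono2) (auto intro: finite_subset less_imp_le)

lemma sum_c_Un: "F \<subseteq> E \<Longrightarrow> G \<subseteq> E \<Longrightarrow> sum c (F \<union> G) \<le> sum c F + sum c G"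
proof -
  assume *: "F \<subseteq> E" "G \<subseteq> E"
  then have "finite F" "finite G" using graph(4) finite_subset by blast+
  then have "sum c (F \<union> G) = sum c F + sum c G - sum c (F \<inter> G)" by (rule sum_Un)
  moreover have "0 \<le> sum c (F \<inter> G)" using * c_pos by (intro sum_nonneg) (auto intro: less_imp_le)
  ultimately show ?thesis by simp
qed

lemma sum_c_UN:
  assumes "finite I" "\<And>i. i \<in> I \<Longrightarrow> F i \<subseteq> E"
  shows "sum c (\<Union>i\<in>I. F i) \<le> (\<Sum>i\<in>I. sum c (F i))"
  using assms
proof (induction I)
  case (insert i I)
  have "sum c (\<Union>i\<in>insert i I. F i) \<le> sum c (F i) + sum c (\<Union>i\<in>I. F i)"
    using insert.prems by (simp, intro sum_c_Un) auto
  with insert show ?case by force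
qed simp

lemma opt_nonneg: "Z \<subseteq> V \<Longrightarrow> 0 \<le> opt Z"
  by (erule opt_obtain) (metis c_pos less_imp_le subsetD sum_nonneg)

lemma opt_singleton [simp]: "v \<in> V \<Longrightarrow> opt {v} = 0"
  using opt_le[of "{}" "{v}"] opt_nonneg[of "{v}"] by (auto simp: connects_def)

lemma opt_mono: "X \<subseteq> Y \<Longrightarrow> Y \<subseteq> V \<Longrightarrow> opt X \<le> opt Y"
  by (metis connects_mono opt_le opt_obtain subset_refl)

lemma opt_Un:
  assumes "X \<subseteq> V" "Y \<subseteq> V" "X \<inter> Y \<noteq> {}"
  shows "opt (X \<union> Y) \<le> opt X + opt Y"
proof -
  obtain F where F: "F \<subseteq> E" "connects F X" "sum c F = opt X" using opt_obtain assms(1) .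
  obtain G where G: "G \<subseteq> E" "connects G Y" "sum c G = opt Y" using opt_obtain assms(2) .
  have "connects (F \<union> G) (X \<union> Y)"
    using connects_mono[OF F(2)] connects_mono[OF G(2)] by (intro connects_Un assms(3)) auto
  then have "opt (X \<union> Y) \<le> sum c (F \<union> G)" using F G by (intro opt_le) auto
  also have "\<dots> \<le> opt X + opt Y" using sum_c_Un[OF F(1) G(1)] F G by simp
  finally show ?thesis .
qed

lemma opt_edge: "{u, v} \<in> E \<Longrightarrow> opt {u, v} \<le> c {u, v}"
  using opt_le[of "{{u, v}}" "{u, v}"] connects_edge[of "{u, v}" "{{u, v}}"] edge_card by simp

section \<open>Classes of terminals and links between them\<close>

abbreviation dist :: "'a set \<Rightarrow> real" where "dist \<equiv> dist_cost V E c"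

lemma opt_le_dist:
  assumes "x \<in> V" "y \<in> V"
  shows "opt {x, y} \<le> dist {x, y}"
proof -
  have "sp_dist V E c x y \<in> {path_length c p | p. upath V E x p y}"
    unfolding sp_dist_def using sp_dist_set[OF inst assms] by (intro Min_in)
  then obtain p where p: "upath V E x p y" "sp_dist V E c x y = path_length c p" by blast
  from upath_connects[OF p(1), of c] c_pos
  obtain F where "F \<subseteq> E" "connects F {x, y}" "sum c F \<le> path_length c p" by blast
  then show ?thesis using opt_le[of F "{x, y}"] p(2) by (simp add: dist_cost_pair)
qed

text \<open>Steps inside a class are free, so this expresses connectivity of the link graph after
  contracting the classes of \<open>P\<close>.\<close>

definition links_rel :: "'a set set \<Rightarrow> 'a set set \<Rightarrow> ('a \<times> 'a) set" where
  "links_rel P L = (\<Union>S\<in>P. S \<times> S) \<union> bidirected L"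

definition spans :: "'a set set \<Rightarrow> 'a set set \<Rightarrow> bool" where
  "spans P L \<longleftrightarrow> L \<subseteq> complete_edges R \<and> R \<times> R \<subseteq> (links_rel P L)\<^sup>*"

lemma sym_links_rel: "sym (links_rel P L)"
  unfolding links_rel_def by (intro sym_Un sym_bidirected) (auto intro: symI)

definition partition :: "'a set set \<Rightarrow> bool" where
  "partition P \<longleftrightarrow> \<Union>P = R \<and> {} \<notin> P \<and> (\<forall>A\<in>P. \<forall>B\<in>P. A \<noteq> B \<longrightarrow> A \<inter> B = {})"

definition separated :: "real \<Rightarrow> 'a set set \<Rightarrow> bool" where
  "separated d P \<longleftrightarrow> (\<forall>A\<in>P. \<forall>B\<in>P. A \<noteq> B \<longrightarrow> (\<forall>x\<in>A. \<forall>y\<in>B. d \<le> dist {x, y}))"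

definition join :: "'a set \<Rightarrow> 'a set \<Rightarrow> 'a set set \<Rightarrow> 'a set set" where
  "join A B P = insert (A \<union> B) (P - {A, B})"

lemma finite_partition: "partition P \<Longrightarrow> finite P"
  using graph(7) by (auto simp: partition_def intro: finite_UnionD)

lemma complete_edges_finite: "finite (complete_edges R)"
  using finite_edges[OF ugraph_complete[OF graph(7)]] .

text \<open>Optimal edge sets of the classes and of the links, each link taken as a two-element set,
  together connect \<open>R\<close>.\<close>

lemma opt_le_spanning:
  assumes P: "partition P" and L: "spans P L"
  shows "opt R \<le> (\<Sum>S\<in>P. opt S) + (\<Sum>e\<in>L. dist e)"
proof -
  have PV: "S \<subseteq> V" if "S \<in> P" for S using P that graph(5) by (auto simp: partition_def)
  have L': "L \<subseteq> complete_edges R" using L by (simp add: spans_def)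
  then have finL: "finite L" using complete_edges_finite finite_subset by blast
  have LV: "e \<subseteq> V \<and> opt e \<le> dist e" if "e \<in> L" for e
    using that L' graph(5) opt_le_dist by (force simp: complete_edges_def)
  have "\<exists>F. F \<subseteq> E \<and> connects F S \<and> sum c F = opt S" if "S \<subseteq> V" for S
    by (rule opt_obtain[OF that]) blast
  then obtain F where F: "\<And>S. S \<subseteq> V \<Longrightarrow> F S \<subseteq> E \<and> connects (F S) S \<and> sum c (F S) = opt S"
    by metis
  let ?G = "(\<Union>S\<in>P. F S) \<union> (\<Union>e\<in>L. F e)"
  have GE: "(\<Union>S\<in>P. F S) \<subseteq> E" "(\<Union>e\<in>L. F e) \<subseteq> E" using F PV LV by blast+
  have *: "S \<times> S \<subseteq> (bidirected ?G)\<^sup>*" if "S \<in> P \<union> L" for S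
  proof -
    have "connects (F S) S" "F S \<subseteq> ?G" using that F PV LV by blast+
    then show ?thesis using connects_mono unfolding connects_def by blast
  qed
  have "links_rel P L \<subseteq> (bidirected ?G)\<^sup>*"
  proof clarify
    fix u v assume "(u, v) \<in> links_rel P L"
    then obtain S where "S \<in> P \<union> L" "u \<in> S" "v \<in> S" by (auto simp: links_rel_def bidirected_def)
    then show "(u, v) \<in> (bidirected ?G)\<^sup>*" using * by blast
  qed
  then have "connects ?G R"
    using L rtrancl_subset_connects unfolding spans_def connects_def by blast
  then have "opt R \<le> sum c ?G" using GE by (intro opt_le) auto
  also have "\<dots> \<le> sum c (\<Union>S\<in>P. F S) + sum c (\<Union>e\<in>L. F e)" using GE by (rule sum_c_Un)
  also have "\<dots> \<le> (\<Sum>S\<in>P. sum c (F S)) + (\<Sum>e\<in>L. sum c (F e))"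
    using F PV LV finL finite_partition[OF P] by (intro add_mono sum_c_UN) blast+
  also have "\<dots> \<le> (\<Sum>S\<in>P. opt S) + (\<Sum>e\<in>L. dist e)"
    using F PV LV by (intro add_mono sum_mono) auto
  finally show ?thesis .
qed

lemma partition_join:
  assumes "partition P" "A \<in> P" "B \<in> P"
  shows "partition (join A B P)"
proof -
  have P: "\<Union>P = R" "{} \<notin> P" using assms(1) by (simp_all add: partition_def)
  have "\<Union>(join A B P) = \<Union>P" using assms(2,3) unfolding join_def by blast
  then have "\<Union>(join A B P) = R" using P(1) by simp
  moreover have "{} \<notin> join A B P" using P(2) assms(2,3) by (auto simp: join_def)
  moreover have "X \<inter> Y = {}" if "X \<in> join A B P" "Y \<in> join A B P" "X \<noteq> Y" for X Y
  proof -
    have *: "S \<inter> T = {}" if "S \<in> P" "T \<in> P" "S \<noteq> T" for S T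
      using assms(1) that by (simp add: partition_def)
    have AB: "(A \<union> B) \<inter> S = {}" if "S \<in> P - {A, B}" for S
      using that *[of A S] *[of B S] assms(2,3) by blast
    from that(1,2) consider "X = A \<union> B" "Y = A \<union> B" | "X = A \<union> B" "Y \<in> P - {A, B}"
      | "Y = A \<union> B" "X \<in> P - {A, B}" | "X \<in> P" "Y \<in> P"
      unfolding join_def by blast
    then show ?thesis
    proof cases
      case 1 then show ?thesis using that(3) by blast
    next
      case 2 then show ?thesis using AB by blast
    next
      case 3 then show ?thesis using AB[of X] by blast
    next
      case 4 then show ?thesis using * that(3) by blast
    qed
  qed
  ultimately show ?thesis unfolding partition_def by blast
qed

lemma join_notin:
  assumes "partition P" "A \<in> P" "B \<in> P" "A \<noteq> B"
  shows "A \<union> B \<notin> P"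
proof
  assume *: "A \<union> B \<in> P"
  have P: "{} \<notin> P" "S \<inter> T = {}" if "S \<in> P" "T \<in> P" "S \<noteq> T" for S T
    using assms(1) that by (simp_all add: partition_def)
  have AB: "A \<inter> B = {}" "{} \<notin> P"
    using P[OF assms(2-4)] by simp_all
  then have ne: "A \<noteq> {}" "B \<noteq> {}" using assms(2,3) by metis+
  with AB(1) have "A \<union> B \<noteq> A" by blast
  from P(2)[OF * assms(2) this] ne(1) show False by simp
qed

lemma sum_join:
  fixes f :: "'a set \<Rightarrow> real"
  assumes "partition P" "A \<in> P" "B \<in> P" "A \<noteq> B"
  shows "sum f (join A B P) = sum f P - f A - f B + f (A \<union> B)"
proof -
  note fin = finite_partition[OF assms(1)]
  have "sum f P = f A + (f B + sum f (P - {A} - {B}))"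
    using fin assms by (simp add: sum.remove[symmetric])
  moreover have "P - {A} - {B} = P - {A, B}" by blast
  ultimately show ?thesis
    unfolding join_def using fin join_notin[OF assms] by (subst sum.insert) auto
qed

lemma card_join:
  assumes "partition P" "A \<in> P" "B \<in> P" "A \<noteq> B"
  shows "Suc (card (join A B P)) = card P"
proof -
  note fin = finite_partition[OF assms(1)]
  have "card (join A B P) = Suc (card (P - {A, B}))"
    unfolding join_def using fin join_notin[OF assms] by (subst card_insert_disjoint) auto
  moreover have "card (P - {A, B}) = card P - 2"
    using assms fin by (subst card_Diff_subset) auto
  moreover have "2 \<le> card P"
    using card_mono[OF fin, of "{A, B}"] assms by auto
  ultimately show ?thesis by simp
qed

lemma separated_join:
  assumes "separated d P" "A \<in> P" "B \<in> P"
  shows "separated d (join A B P)"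
proof -
  have *: "d \<le> dist {x, y}" if "S \<in> P" "T \<in> P" "S \<noteq> T" "x \<in> S" "y \<in> T" for S T x y
    using assms(1) that by (simp add: separated_def)
  show ?thesis
    unfolding separated_def
  proof (intro ballI impI)
    fix X Y x y assume XY: "X \<in> join A B P" "Y \<in> join A B P" "X \<noteq> Y" "x \<in> X" "y \<in> Y"
    from XY(1-3) consider "X = A \<union> B" "Y \<in> P - {A, B}" | "Y = A \<union> B" "X \<in> P - {A, B}"
      | "X \<in> P" "Y \<in> P" unfolding join_def by blast
    then show "d \<le> dist {x, y}"
    proof cases
      case 1 then show ?thesis using *[of A Y x y] *[of B Y x y] assms(2,3) XY(4,5) by blast
    next
      case 2 then show ?thesis using *[of X A x y] *[of X B x y] assms(2,3) XY(4,5) by blast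
    next
      case 3 then show ?thesis using * XY(3-5) by blast
    qed
  qed
qed

text \<open>The link is the last one by which a walk from \<open>A\<close> to \<open>B\<close> leaves \<open>A\<close>: the rest of
  the walk avoids it, so it becomes redundant once \<open>A\<close> and \<open>B\<close> are joined.\<close>

lemma spans_join:
  assumes P: "partition P" and L: "spans P L" and sep: "separated d P"
    and AB: "A \<in> P" "B \<in> P" "A \<noteq> B"
  shows "\<exists>L'. spans (join A B P) L' \<and> (\<Sum>e\<in>L'. dist e) \<le> (\<Sum>e\<in>L. dist e) - d"
proof -
  have ABR: "A \<subseteq> R" "B \<subseteq> R" "A \<noteq> {}" "B \<noteq> {}" "A \<inter> B = {}"
    using P AB unfolding partition_def by blast+
  obtain a b where ab: "a \<in> A" "b \<in> B" using ABR by blast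
  let ?r = "links_rel P L"
  have "(a, b) \<in> ?r\<^sup>*" using L ab ABR unfolding spans_def by blast
  moreover have "b \<notin> A" using ab ABR by blast
  ultimately obtain x y where xy: "x \<in> A" "y \<notin> A" "(x, y) \<in> ?r"
    "(y, b) \<in> (?r \<inter> (- A) \<times> (- A))\<^sup>*"
    using rtrancl_last_departure ab(1) by metis
  have "(x, y) \<notin> (\<Union>S\<in>P. S \<times> S)"
    using xy(1,2) P AB(1) unfolding partition_def by blast
  then have e: "{x, y} \<in> L" using xy(3) by (auto simp: links_rel_def bidirected_def)
  then have "y \<in> R" using L by (auto simp: spans_def complete_edges_def doubleton_eq_iff)
  then obtain S where S: "S \<in> P" "y \<in> S" using P by (auto simp: partition_def)
  then have d: "d \<le> dist {x, y}"
    using sep xy(1,2) AB(1) unfolding separated_def by blast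
  let ?L = "L - {{x, y}}" and ?s = "links_rel (join A B P) (L - {{x, y}})"
  have fin: "finite L" using L complete_edges_finite finite_subset unfolding spans_def by blast
  have classes: "(\<Union>S\<in>P. S \<times> S) \<subseteq> ?s" by (auto simp: links_rel_def join_def)
  have "?r \<inter> (- A) \<times> (- A) \<subseteq> ?s"
    using classes xy(1) by (auto simp: links_rel_def bidirected_def doubleton_eq_iff)
  then have "(y, b) \<in> ?s\<^sup>*" using xy(4) rtrancl_mono by blast
  moreover have "(b, x) \<in> ?s" using ab xy(1) by (auto simp: links_rel_def join_def)
  ultimately have yx: "(y, x) \<in> ?s\<^sup>*" by (rule rtrancl_into_rtrancl)
  then have xy': "(x, y) \<in> ?s\<^sup>*" by (meson sym_links_rel sym_rtrancl symD)
  have "bidirected L \<subseteq> ?s\<^sup>*"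
  proof clarify
    fix u v assume uv: "(u, v) \<in> bidirected L"
    show "(u, v) \<in> ?s\<^sup>*"
    proof (cases "{u, v} = {x, y}")
      case True
      with xy' yx show ?thesis by (auto simp: doubleton_eq_iff)
    next
      case False
      with uv have "(u, v) \<in> ?s" by (auto simp: bidirected_def links_rel_def)
      then show ?thesis by blast
    qed
  qed
  then have "?r \<subseteq> ?s\<^sup>*" using classes unfolding links_rel_def by blast
  then have "spans (join A B P) ?L"
    using L rtrancl_subset_connects unfolding spans_def by blast
  moreover have "(\<Sum>e\<in>?L. dist e) \<le> (\<Sum>e\<in>L. dist e) - d"
    using fin e d by (simp add: sum_diff1)
  ultimately show ?thesis by blast
qed

text \<open>An invariant as in Kruskal's algorithm: optimal connections of the classes and suitable
  links form an optimal connection of \<open>R\<close>. The reverse inequality is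
  \<open>opt_le_spanning\<close>.\<close>

definition tight_partition :: "'a set set \<Rightarrow> bool" where
  "tight_partition P \<longleftrightarrow>
     partition P \<and> (\<exists>L. spans P L \<and> (\<Sum>S\<in>P. opt S) + (\<Sum>e\<in>L. dist e) \<le> opt R)"

text \<open>Otherwise a connection of \<open>A \<union> B\<close> could replace those of
  \<open>A\<close> and \<open>B\<close> and, by \<open>spans_join\<close>, links worth
  \<open>d\<close>; then \<open>R\<close> would be connected below its optimum.\<close>

lemma opt_pair_ge:
  assumes "tight_partition P" "separated d P" "A \<in> P" "B \<in> P" "A \<noteq> B"
  shows "opt A + opt B + d \<le> opt (A \<union> B)"
proof -
  obtain L where P: "partition P" and L: "spans P L"
    "(\<Sum>S\<in>P. opt S) + (\<Sum>e\<in>L. dist e) \<le> opt R"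
    using assms(1) by (auto simp: tight_partition_def)
  from spans_join[OF P L(1) assms(2-5)] obtain L' where L': "spans (join A B P) L'"
    "(\<Sum>e\<in>L'. dist e) \<le> (\<Sum>e\<in>L. dist e) - d" by blast
  from opt_le_spanning[OF partition_join[OF P assms(3,4)] L'(1)] L'(2) L(2)
  show ?thesis by (simp add: sum_join[OF P assms(3-5)])
qed

text \<open>The exchange of \<open>opt_pair_ge\<close> made twice; \<open>separated d\<close>
  survives the first join.\<close>

lemma opt_triple_ge:
  assumes "tight_partition P" "separated d P" "A \<in> P" "B \<in> P" "C \<in> P"
    and "A \<noteq> B" "A \<noteq> C" "B \<noteq> C"
  shows "opt A + opt B + opt C + 2 * d \<le> opt (A \<union> B \<union> C)"
proof -
  obtain L where P: "partition P" and L: "spans P L"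
    "(\<Sum>S\<in>P. opt S) + (\<Sum>e\<in>L. dist e) \<le> opt R"
    using assms(1) by (auto simp: tight_partition_def)
  let ?P = "join A B P"
  note P' = partition_join[OF P assms(3,4)]
  have AB: "A \<union> B \<in> ?P" "C \<in> ?P" "A \<union> B \<noteq> C"
    using assms join_notin[OF P assms(3,4)] by (auto simp: join_def)
  from spans_join[OF P L(1) assms(2-4,6)] obtain L' where L': "spans ?P L'"
    "(\<Sum>e\<in>L'. dist e) \<le> (\<Sum>e\<in>L. dist e) - d" by blast
  from spans_join[OF P' L'(1) separated_join[OF assms(2-4)] AB]
  obtain L'' where L'': "spans (join (A \<union> B) C ?P) L''"
    "(\<Sum>e\<in>L''. dist e) \<le> (\<Sum>e\<in>L'. dist e) - d" by blast
  from opt_le_spanning[OF partition_join[OF P' AB(1,2)] L''(1)] L''(2) L'(2) L(2)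
  show ?thesis
    by (simp add: sum_join[OF P assms(3,4,6)] sum_join[OF P' AB])
qed

text \<open>The pair \<open>{x, y}\<close> meets \<open>Z\<close> in \<open>x\<close> and
  \<open>B\<close> in \<open>y\<close>. A general \<open>Z\<close> lets \<open>merge\<close> apply
  this to trees with further vertices and components.\<close>

lemma opt_join_le:
  assumes "x \<in> A" "y \<in> B" "A \<subseteq> Z" "Z \<subseteq> V" "B \<subseteq> V"
  shows "opt (Z \<union> B) \<le> opt Z + opt B + dist {x, y}"
proof -
  have "opt (Z \<union> {x, y}) \<le> opt Z + opt {x, y}" using assms by (intro opt_Un) auto
  moreover have "opt ((Z \<union> {x, y}) \<union> B) \<le> opt (Z \<union> {x, y}) + opt B"
    using assms by (intro opt_Un) auto
  moreover have "(Z \<union> {x, y}) \<union> B = Z \<union> B" using assms by auto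
  moreover have "opt {x, y} \<le> dist {x, y}" using assms by (intro opt_le_dist) auto
  ultimately show ?thesis by simp
qed

text \<open>A link of length exactly \<open>d\<close> makes \<open>opt_pair_ge\<close> an equality,
  so the classes gain no more than the links lose.\<close>

lemma tight_partition_join:
  assumes "tight_partition P" "separated d P" "A \<in> P" "B \<in> P" "A \<noteq> B"
    and "x \<in> A" "y \<in> B" "dist {x, y} = d"
  shows "tight_partition (join A B P)"
    and "opt (A \<union> B) = opt A + opt B + d"
proof -
  obtain L where P: "partition P" and L: "spans P L"
    "(\<Sum>S\<in>P. opt S) + (\<Sum>e\<in>L. dist e) \<le> opt R"
    using assms(1) by (auto simp: tight_partition_def)
  have AB: "A \<subseteq> V" "B \<subseteq> V" using P assms(3,4) graph(5) by (auto simp: partition_def)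
  show *: "opt (A \<union> B) = opt A + opt B + d"
    using opt_pair_ge[OF assms(1-5)] opt_join_le[OF assms(6,7) subset_refl AB] assms(8) by simp
  from spans_join[OF P L(1) assms(2-5)] obtain L' where L': "spans (join A B P) L'"
    "(\<Sum>e\<in>L'. dist e) \<le> (\<Sum>e\<in>L. dist e) - d" by blast
  with L(2) * have "(\<Sum>S\<in>join A B P. opt S) + (\<Sum>e\<in>L'. dist e) \<le> opt R"
    by (simp add: sum_join[OF P assms(3-5)])
  then show "tight_partition (join A B P)"
    using partition_join[OF P assms(3,4)] L'(1) unfolding tight_partition_def by blast
qed

lemma closest_pair:
  assumes "partition P" "card P \<noteq> 1"
  obtains A B x y where "A \<in> P" "B \<in> P" "A \<noteq> B" "x \<in> A" "y \<in> B" "separated (dist {x, y}) P"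
proof -
  define Q where "Q = {(x, y). \<exists>A\<in>P. \<exists>B\<in>P. A \<noteq> B \<and> x \<in> A \<and> y \<in> B}"
  have P: "\<Union>P = R" "{} \<notin> P" using assms(1) by (auto simp: partition_def)
  from P(1) graph(6) obtain A where A: "A \<in> P" by blast
  have "P \<noteq> {A}" using assms(2) by auto
  then obtain B where B: "B \<in> P" "B \<noteq> A" using A by blast
  have "A \<noteq> {}" "B \<noteq> {}" using P(2) A B(1) by metis+
  then obtain a b where "a \<in> A" "b \<in> B" by blast
  then have "(a, b) \<in> Q" unfolding Q_def using A B by blast
  moreover have "Q \<subseteq> R \<times> R" unfolding Q_def P(1)[symmetric] by blast
  then have "finite Q" using graph(7) finite_subset by blast
  ultimately obtain x y where q: "is_arg_min (\<lambda>(x, y). dist {x, y}) (\<lambda>q. q \<in> Q) (x, y)"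
    using ex_is_arg_min_if_finite[of Q "\<lambda>(x, y). dist {x, y}"] by (metis empty_iff surj_pair)
  then have min: "dist {x, y} \<le> dist {x', y'}" if "(x', y') \<in> Q" for x' y'
    using that by (auto simp: is_arg_min_linorder)
  from q have "(x, y) \<in> Q" by (simp add: is_arg_min_def)
  then obtain A B where AB: "A \<in> P" "B \<in> P" "A \<noteq> B" "x \<in> A" "y \<in> B"
    unfolding Q_def by blast
  have "separated (dist {x, y}) P"
    unfolding separated_def
  proof (intro ballI impI)
    fix S T x' y' assume "S \<in> P" "T \<in> P" "S \<noteq> T" "x' \<in> S" "y' \<in> T"
    then have "(x', y') \<in> Q" unfolding Q_def by blast
    then show "dist {x, y} \<le> dist {x', y'}" by (rule min)
  qed
  with AB show thesis by (rule that)
qed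

text \<open>In an optimal edge set the component of one terminal contains all of \<open>R\<close>; a
  spanning tree of this component is a Steiner tree.\<close>

lemma OPT_le_opt: "OPT V E c R \<le> opt R"
proof -
  obtain F where F: "F \<subseteq> E" "connects F R" "sum c F = opt R" using opt_obtain graph(5) .
  obtain s where s: "s \<in> R" using graph(6) by blast
  define W where "W = {v. (s, v) \<in> (bidirected F)\<^sup>*}"
  define G where "G = {e \<in> F. e \<subseteq> W}"
  have WV: "W \<subseteq> V"
  proof
    fix v assume "v \<in> W"
    then have "(s, v) \<in> (bidirected F)\<^sup>*" by (simp add: W_def)
    then show "v \<in> V"
      using s graph(5) F(1) edge_in_V(2) by cases (auto simp: bidirected_def)
  qed
  have RW: "R \<subseteq> W" using F(2) s by (auto simp: W_def connects_def)
  have ug: "ugraph W G"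
    using WV finite_subset[OF WV graph(3)] F(1) edge_card by (auto simp: ugraph_def G_def)
  have sW: "(s, v) \<in> (bidirected G)\<^sup>*" if "(s, v) \<in> (bidirected F)\<^sup>*" for v
    using that
  proof (induction rule: rtrancl_induct)
    case (step u v)
    then have "u \<in> W" "v \<in> W" by (auto simp: W_def)
    then have "(u, v) \<in> bidirected G" using step.hyps(2) by (auto simp: G_def bidirected_def)
    then show ?case using step.IH by (rule rtrancl_into_rtrancl[rotated])
  qed simp
  have "(u, v) \<in> (bidirected G)\<^sup>*" if "u \<in> W" "v \<in> W" for u v
  proof -
    have "(s, u) \<in> (bidirected G)\<^sup>*" "(s, v) \<in> (bidirected G)\<^sup>*"
      using that sW by (auto simp: W_def)
    then show ?thesis by (meson sym_bidirected sym_rtrancl symD rtrancl_trans)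
  qed
  then have "uconnected W G" using RW graph(6) by (subst uconnected_iff[OF ug]) auto
  from spanning_tree_exists[OF ug this] obtain T where T: "usubgraph W T W G" "utree W T" by blast
  then have TG: "T \<subseteq> G" by (simp add: usubgraph_def)
  then have TE: "T \<subseteq> F" by (auto simp: G_def)
  then have "steiner_tree V E R W T"
    using T RW WV F(1) by (auto simp: steiner_tree_def usubgraph_def)
  then have "OPT V E c R \<le> sum c T"
    unfolding OPT_def using OPT_set[OF inst] by (intro Min_le) auto
  also have "\<dots> \<le> opt R" using sum_c_mono[OF TE F(1)] F(3) by simp
  finally show ?thesis .
qed

text \<open>This is where MST-optimality enters: singletons cost nothing, and a terminal MST costs
  \<open>OPT\<close>, which is at most \<open>opt R\<close>.\<close>

lemma tight_partition_singletons:
  assumes "MST_optimal V E c R"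
  shows "tight_partition ((\<lambda>s. {s}) ` R)"
proof -
  let ?S = "{sum dist F | F. usubgraph R F R (complete_edges R) \<and> utree R F}"
  have "TMST V E c R \<in> ?S"
    unfolding TMST_def mst_cost_def using TMST_set[OF inst] by (intro Min_in) auto
  then obtain L where L: "usubgraph R L R (complete_edges R)" "utree R L"
    "sum dist L = TMST V E c R" by auto
  have "uconnected R L" "ugraph R L" using L by (auto simp: utree_def)
  then have "R \<times> R \<subseteq> (bidirected L)\<^sup>*" using uconnected_iff by blast
  moreover have "bidirected L \<subseteq> links_rel P L" for P by (simp add: links_rel_def)
  ultimately have "R \<times> R \<subseteq> (links_rel P L)\<^sup>*" for P using rtrancl_mono by blast
  then have "spans ((\<lambda>s. {s}) ` R) L" using L(1) by (simp add: spans_def usubgraph_def)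
  moreover have "(\<Sum>S\<in>(\<lambda>s. {s}) ` R. opt S) = 0"
    using graph(5) by (intro sum.neutral) auto
  moreover have "sum dist L \<le> opt R"
    using assms OPT_le_opt L(3) by (simp add: MST_optimal_def)
  moreover have "partition ((\<lambda>s. {s}) ` R)" by (auto simp: partition_def)
  ultimately show ?thesis by (auto simp: tight_partition_def)
qed


section \<open>Excess costs over the optima of components\<close>

definition Phi :: "'a set \<Rightarrow> 'a \<Rightarrow> real" where
  "Phi A v = opt (insert v A) - opt A"

text \<open>What a tree through \<open>A\<close>, \<open>B\<close> and \<open>v\<close> costs beyond
  the two components themselves; \<open>del\<close> is the same without \<open>v\<close>.\<close>

definition Psi :: "'a set \<Rightarrow> 'a set \<Rightarrow> 'a \<Rightarrow> real" where
  "Psi A B v = opt (insert v (A \<union> B)) - opt A - opt B"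

definition del :: "'a set \<Rightarrow> 'a set \<Rightarrow> real" where
  "del A B = opt (A \<union> B) - opt A - opt B"

lemma Psi_commute: "Psi A B v = Psi B A v" and del_commute: "del A B = del B A"
  by (simp_all add: Psi_def del_def Un_commute)

lemma opt_insert_edge:
  assumes "{v, w} \<in> E" "A \<subseteq> V"
  shows "opt (insert v (insert w A)) \<le> opt (insert v A) + c {v, w}"
proof -
  have "opt (insert v A \<union> {v, w}) \<le> opt (insert v A) + opt {v, w}"
    using assms edge_in_V by (intro opt_Un) auto
  moreover have "insert v A \<union> {v, w} = insert v (insert w A)" by blast
  ultimately show ?thesis using opt_edge[OF assms(1)] by simp
qed

lemma opt_step:
  assumes "{v, w} \<in> E" "A \<subseteq> V"
  shows "opt (insert w A) \<le> opt (insert v A) + c {v, w}"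
  using opt_insert_edge[OF assms] opt_mono[of "insert w A" "insert v (insert w A)"] assms edge_in_V
  by force

lemma Phi_step: "{v, w} \<in> E \<Longrightarrow> A \<subseteq> V \<Longrightarrow> Phi A w \<le> Phi A v + c {v, w}"
  unfolding Phi_def using opt_step[of v w A] by simp

lemma Psi_step: "{v, w} \<in> E \<Longrightarrow> A \<subseteq> V \<Longrightarrow> B \<subseteq> V \<Longrightarrow> Psi A B w \<le> Psi A B v + c {v, w}"
  unfolding Psi_def using opt_step[of v w "A \<union> B"] by simp

lemma Phi_nonneg: "A \<subseteq> V \<Longrightarrow> v \<in> V \<Longrightarrow> 0 \<le> Phi A v"
  unfolding Phi_def using opt_mono[of A "insert v A"] by auto

lemma del_le_Psi: "A \<subseteq> V \<Longrightarrow> B \<subseteq> V \<Longrightarrow> v \<in> V \<Longrightarrow> del A B \<le> Psi A B v"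
  unfolding del_def Psi_def using opt_mono[of "A \<union> B" "insert v (A \<union> B)"] by auto

lemma opt_insert_Un:
  assumes "A \<subseteq> V" "B \<subseteq> V" "v \<in> V"
  shows "opt (insert v (A \<union> B)) \<le> opt (insert v A) + opt (insert v B)"
  using opt_Un[of "insert v A" "insert v B"] assms by simp

lemma Psi_le_Phi:
  "A \<subseteq> V \<Longrightarrow> B \<subseteq> V \<Longrightarrow> v \<in> V \<Longrightarrow> Psi A B v \<le> Phi A v + Phi B v"
  unfolding Psi_def Phi_def using opt_insert_Un[of A B v] by simp

lemma partition_subset: "tight_partition P \<Longrightarrow> A \<in> P \<Longrightarrow> A \<subseteq> V"
  using graph(5) by (auto simp: tight_partition_def partition_def)

lemma del_ge:
  "tight_partition P \<Longrightarrow> separated d P \<Longrightarrow> A \<in> P \<Longrightarrow> B \<in> P \<Longrightarrow> A \<noteq> B \<Longrightarrow> d \<le> del A B"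
  using opt_pair_ge[of P d A B] by (simp add: del_def)

text \<open>A tree for \<open>A\<close>, \<open>B\<close>, \<open>v\<close> and one for
  \<open>X\<close>, \<open>v\<close> meet in \<open>v\<close> and join three components, which costs
  two links by \<open>opt_triple_ge\<close>. This keeps a third component away from a
  vertex.\<close>

lemma Psi_Phi_ge:
  assumes "tight_partition P" "separated d P" "A \<in> P" "B \<in> P" "X \<in> P"
    and "A \<noteq> B" "A \<noteq> X" "B \<noteq> X" and v: "v \<in> V"
  shows "2 * d \<le> Psi A B v + Phi X v"
proof -
  have V: "A \<subseteq> V" "B \<subseteq> V" "X \<subseteq> V" using partition_subset assms by blast+
  have "opt A + opt B + opt X + 2 * d \<le> opt (A \<union> B \<union> X)"
    using assms by (intro opt_triple_ge) auto
  also have "\<dots> \<le> opt (insert v (A \<union> B \<union> X))" using V v by (intro opt_mono) auto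
  also have "\<dots> \<le> opt (insert v (A \<union> B)) + opt (insert v X)"
    using V v by (intro opt_insert_Un) auto
  finally show ?thesis by (simp add: Psi_def Phi_def)
qed

end

section \<open>States of the dual growth\<close>

text \<open>\<open>t\<close> is the time, \<open>P\<close> the set of components, \<open>C v\<close> the set of components that have
  reached \<open>v\<close>, \<open>l v w\<close> the load of the arc \<open>(v, w)\<close>, \<open>tau A v\<close> the time when the first part of
  \<open>A\<close> arrived at \<open>v\<close>, and \<open>cl\<close> the set of vertices at which two components met that have been
  merged since; no further component ever reaches these. Arrival times are meaningless on \<open>cl\<close>.

  Assumption \<open>common\<close> bounds what a second component pays for following \<open>X\<close> along an arc. Its first
  alternative fails if the ends of the arc were reached by different parts of \<open>X\<close>; then the second
  one says that the arc is too expensive to be passed before a merger.\<close>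

locale growth_state = steiner V E c R
  for V :: "'a set" and E :: "'a set set" and c :: "'a set \<Rightarrow> real" and R :: "'a set" +
  fixes D t :: real and P :: "'a set set" and C :: "'a \<Rightarrow> 'a set set"
    and l :: "'a \<Rightarrow> 'a \<Rightarrow> real" and tau :: "'a set \<Rightarrow> 'a \<Rightarrow> real" and cl :: "'a set"
  assumes D: "12 / 7 < D" "D \<le> 2"
    and tp: "tight_partition P" and sep: "separated (D * t) P" and t: "0 \<le> t"
    and C_P: "S \<in> C v \<Longrightarrow> S \<in> P" and C_V: "S \<in> C v \<Longrightarrow> v \<in> V"
    and own: "S \<in> P \<Longrightarrow> s \<in> S \<Longrightarrow> S \<in> C s"
    and own_only: "s \<in> R \<Longrightarrow> S \<in> C s \<Longrightarrow> s \<in> S"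
    and closed_C: "v \<in> cl \<Longrightarrow> \<exists>X. C v = {X}"
    and two: "A \<in> C v \<Longrightarrow> B \<in> C v \<Longrightarrow> X \<in> C v \<Longrightarrow> A = B \<or> A = X \<or> B = X"
    and tau: "v \<notin> cl \<Longrightarrow> A \<in> C v \<Longrightarrow> 0 \<le> tau A v \<and> tau A v \<le> t"
    and Phi_one: "v \<notin> cl \<Longrightarrow> C v = {A} \<Longrightarrow> Phi A v \<le> tau A v"
    and Phi_first: "v \<notin> cl \<Longrightarrow> A \<in> C v \<Longrightarrow> B \<in> C v \<Longrightarrow> tau A v < tau B v \<Longrightarrow> Phi A v \<le> tau A v"
    and Phi_two: "v \<notin> cl \<Longrightarrow> A \<in> C v \<Longrightarrow> B \<in> C v \<Longrightarrow> A \<noteq> B \<Longrightarrow>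
      Phi A v \<le> 2 * tau A v + tau B v - del A B"
    and Psi_two: "v \<notin> cl \<Longrightarrow> A \<in> C v \<Longrightarrow> B \<in> C v \<Longrightarrow> A \<noteq> B \<Longrightarrow>
      Psi A B v \<le> tau A v + tau B v + max (tau A v) (tau B v) - del A B / 2"
    and closed: "v \<in> cl \<Longrightarrow> X \<in> C v \<Longrightarrow> Phi X v \<le> 3 * t - 3 / 2 * (D * t)"
    and closed_arc: "v \<in> cl \<Longrightarrow> X \<in> C v \<Longrightarrow> {v, w} \<in> E \<Longrightarrow> Phi X v + l v w \<le> t"
    and l_nonneg: "{v, w} \<in> E \<Longrightarrow> 0 \<le> l v w"
    and l_cap: "{v, w} \<in> E \<Longrightarrow> l v w \<le> c {v, w}"
    and l_up: "{v, w} \<in> E \<Longrightarrow> v \<notin> cl \<Longrightarrow> l v w \<le> (\<Sum>A\<in>C v. t - tau A v)"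
    and l_lo: "{v, w} \<in> E \<Longrightarrow> v \<notin> cl \<Longrightarrow> A \<in> C v \<Longrightarrow> A \<notin> C w \<Longrightarrow> t - tau A v \<le> l v w"
    and lip: "{v, w} \<in> E \<Longrightarrow> v \<notin> cl \<Longrightarrow> w \<notin> cl \<Longrightarrow> A \<in> C v \<Longrightarrow> A \<in> C w \<Longrightarrow>
      tau A v \<le> tau A w + c {v, w}"
    and common: "{v, w} \<in> E \<Longrightarrow> v \<notin> cl \<Longrightarrow> w \<notin> cl \<Longrightarrow> C w = {X} \<Longrightarrow> X \<in> C v \<Longrightarrow>
      l v w \<le> (\<Sum>A\<in>C v - {X}. t - tau A v) + max 0 (tau X w - tau X v) \<or>
      opt (insert v (insert w (\<Union>(C v)))) - (\<Sum>A\<in>C v. opt A) + l v w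
        \<le> c {v, w} + (if C v = {X} then 2 * t - D * t else 5 * t - 2 * (D * t))"
begin

lemma Dt: "12 / 7 * t \<le> D * t" "D * t \<le> 2 * t" "0 < t \<Longrightarrow> 12 / 7 * t < D * t"
  using mult_right_mono[OF less_imp_le[OF D(1)] t] mult_right_mono[OF D(2) t]
    mult_strict_right_mono[OF D(1), of t] by simp_all

lemma P_V: "A \<in> P \<Longrightarrow> A \<subseteq> V"
  using tp partition_subset by blast

lemma C_sub_V: "A \<in> C v \<Longrightarrow> A \<subseteq> V"
  using C_P P_V by blast

lemma part: "partition P"
  using tp by (simp add: tight_partition_def)

lemma fin_P: "finite P"
  using finite_partition part .

lemma fin_C: "finite (C v)"
  using fin_P C_P by (meson finite_subset subsetI)

lemma C_cases:
  obtains "C v = {}" "v \<notin> cl" | A where "C v = {A}"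
  | A B where "A \<noteq> B" "C v = {A, B}" "v \<notin> cl"
proof -
  consider "C v = {}" | A where "C v = {A}" | A B where "A \<in> C v" "B \<in> C v" "A \<noteq> B"
    by blast
  then show thesis
  proof cases
    case 1
    moreover from 1 have "v \<notin> cl" using closed_C[of v] by auto
    ultimately show thesis by (rule that(1))
  next
    case 2
    then show thesis by (rule that(2))
  next
    case (3 A B)
    have "C v = {A, B}"
    proof
      show "C v \<subseteq> {A, B}" using two[OF 3(1,2)] 3(3) by blast
    qed (use 3 in blast)
    moreover from this have "v \<notin> cl" using closed_C[of v] 3(3) by auto
    ultimately show thesis using that(3) 3(3) by blast
  qed
qed

lemma del_Dt: "A \<in> P \<Longrightarrow> B \<in> P \<Longrightarrow> A \<noteq> B \<Longrightarrow> D * t \<le> del A B"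
  using del_ge[OF tp sep] .

section \<open>The two ends of a fully loaded arc\<close>

context
  fixes u p
  assumes e: "{u, p} \<in> E" and full: "l u p = c {u, p}"
begin

lemma p_V: "p \<in> V" "u \<in> V"
  using e edge_in_V by auto

text \<open>Outside \<open>cl\<close>, \<open>B\<close> alone loads the arc, for at most
  \<open>t - tau B u\<close>; added to \<open>Phi B u \<le> tau B u\<close> this gives
  \<open>t\<close>. On \<open>cl\<close> it is \<open>closed_arc\<close>.\<close>

lemma tail_one:
  assumes "C u = {B}"
  shows "Phi B p \<le> t"
proof -
  have "Phi B p \<le> Phi B u + l u p"
    using Phi_step[OF e] C_sub_V[of B u] assms full by simp
  also have "\<dots> \<le> t"
  proof (cases "u \<in> cl")
    case True
    then show ?thesis using closed_arc[OF True _ e] assms by simp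
  next
    case False
    then show ?thesis using Phi_one[OF False assms] l_up[OF e False] assms by simp
  qed
  finally show ?thesis .
qed

text \<open>Both components pay for the arc, so it costs at most
  \<open>2 * t - tau A u - tau B u\<close>. This cancels arrival times in \<open>Phi_two\<close> and
  \<open>Psi_two\<close>; the one left over is at most \<open>t\<close>.\<close>

lemma tail_two:
  assumes "A \<noteq> B" "C u = {A, B}"
  shows "Phi A p \<le> 3 * t - del A B" "Psi A B p \<le> 3 * t - del A B / 2"
proof -
  have u: "u \<notin> cl" using closed_C[of u] assms by auto
  have AB: "A \<in> C u" "B \<in> C u" using assms by auto
  have l: "l u p \<le> 2 * t - tau A u - tau B u" using l_up[OF e u] assms by simp
  note ta = tau[OF u AB(1)] tau[OF u AB(2)]
  have "Phi A p \<le> Phi A u + l u p"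
    using Phi_step[OF e] C_sub_V[OF AB(1)] full by simp
  then show "Phi A p \<le> 3 * t - del A B" using Phi_two[OF u AB assms(1)] l ta by linarith
  have "Psi A B p \<le> Psi A B u + l u p"
    using Psi_step[OF e] C_sub_V AB full by simp
  moreover have "max (tau A u) (tau B u) \<le> t" using ta by simp
  ultimately show "Psi A B p \<le> 3 * t - del A B / 2"
    using Psi_two[OF u AB assms(1)] l by linarith
qed

text \<open>One bound for all tails: \<open>t \<le> 3 * t - D * t\<close> since
  \<open>D \<le> 2\<close>, and \<open>del\<close> is at least \<open>D * t\<close>.\<close>

lemma tail_crude:
  assumes "B \<in> C u"
  shows "Phi B p \<le> 3 * t - D * t"
proof (cases rule: C_cases[of u])
  case (2 A)
  then show ?thesis using tail_one[of B] assms Dt by auto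
next
  case (3 X Y)
  then obtain A where A: "A \<noteq> B" "C u = {B, A}" using assms by auto
  then have "A \<in> P" "B \<in> P" using C_P[of _ u] by auto
  then show ?thesis using tail_two(1)[of B A] A del_Dt[of B A] by force
qed (use assms in auto)

text \<open>At time zero nothing is loaded, but edges have positive cost. The strict inequality in
  \<open>Dt\<close> depends on this.\<close>

lemma t_pos:
  assumes "B \<in> C u"
  shows "0 < t"
proof (rule ccontr)
  assume "\<not> 0 < t"
  then have t0: "t = 0" using t by simp
  have "l u p \<le> 0"
  proof (cases "u \<in> cl")
    case True
    then show ?thesis
      using closed_arc[OF True assms e] Phi_nonneg[OF C_sub_V[OF assms] p_V(2)] t0 by simp
  next
    case False
    have "(\<Sum>A\<in>C u. t - tau A u) \<le> 0" using tau[OF False] t0 by (intro sum_nonpos) auto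
    then show ?thesis using l_up[OF e False] by simp
  qed
  then show False using full c_pos[OF e] by simp
qed

text \<open>If \<open>B\<close> came to a vertex of \<open>cl\<close>, or as a third component,
  there would be trees too cheap for the distances between components. Two of the cases need exactly
  \<open>12 / 7 < D\<close>.\<close>

lemma head_le_one:
  assumes B: "B \<in> C u" "B \<notin> C p"
  shows "p \<notin> cl" "C p = {} \<or> (\<exists>A. C p = {A} \<and> C u \<subseteq> {A, B})"
proof -
  note t0 = t_pos[OF B(1)] and BP = C_P[OF B(1)]
  note Dt' = Dt(1) Dt(3)[OF t0] t0
  show p: "p \<notin> cl"
  proof
    assume p: "p \<in> cl"
    then obtain X where X: "C p = {X}" using closed_C by blast
    then have XP: "X \<in> P" "X \<noteq> B" using C_P[of X p] B(2) by auto
    have "D * t \<le> del X B" using del_Dt XP BP by simp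
    also have "\<dots> \<le> Phi X p + Phi B p"
      using del_le_Psi[of X B p] Psi_le_Phi[of X B p] P_V XP BP p_V by force
    also have "\<dots> \<le> (3 * t - 3 / 2 * (D * t)) + (3 * t - D * t)"
      using closed[OF p] X tail_crude[OF B(1)] by (intro add_mono) auto
    \<comment> \<open>The chain amounts to \<open>7 / 2 * (D * t) \<le> 6 * t\<close>, that is,
      \<open>D \<le> 12 / 7\<close>.\<close>
    finally show False using Dt' by simp
  qed
  show "C p = {} \<or> (\<exists>A. C p = {A} \<and> C u \<subseteq> {A, B})"
  proof (cases rule: C_cases[of p])
    case (2 A)
    have AP: "A \<in> P" "A \<noteq> B" using 2 C_P[of A p] B(2) by auto
    have "C u \<subseteq> {A, B}"
    proof (rule ccontr)
      assume "\<not> C u \<subseteq> {A, B}"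
      then obtain X where X: "X \<in> C u" "X \<noteq> A" "X \<noteq> B" by blast
      then have u: "C u = {X, B}" using B(1) two[of X u B] by blast
      then have "A \<notin> C u" using X AP by auto
      note XP = C_P[OF X(1)]
      have "2 * (D * t) \<le> Psi X B p + Phi A p"
        using X AP XP BP p_V by (intro Psi_Phi_ge[OF tp sep]) auto
      also have "\<dots> \<le> 3 * t - D * t / 2 + t"
        using tail_two(2)[OF X(3) u] del_Dt[OF XP BP X(3)] Phi_one[OF p 2]
          tau[OF p, of A] 2 by force
      \<comment> \<open>This case is not critical: \<open>5 / 2 * (D * t) \<le> 4 * t\<close> means
        \<open>D \<le> 8 / 5\<close>.\<close>
      finally show False using Dt' by simp
    qed
    with 2 show ?thesis by blast
  next
    case (3 A A')
    have AP: "A \<in> P" "A' \<in> P" "A \<noteq> B" "A' \<noteq> B" using 3 C_P[of _ p] B(2) by auto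
    have "2 * (D * t) \<le> Psi A A' p + Phi B p"
      using 3 AP BP p_V by (intro Psi_Phi_ge[OF tp sep]) auto
    also have "\<dots> \<le> (3 * t - D * t / 2) + (3 * t - D * t)"
    proof (intro add_mono tail_crude B(1))
      have "tau A p \<le> t" "tau A' p \<le> t" using tau[OF p] 3 by auto
      then show "Psi A A' p \<le> 3 * t - D * t / 2"
        using Psi_two[OF p, of A A'] 3 del_Dt[of A A'] AP by force
    qed
    \<comment> \<open>Critical again: \<open>7 / 2 * (D * t) \<le> 6 * t\<close>.\<close>
    finally show ?thesis using Dt' by simp
  qed simp
qed

text \<open>With arrival time \<open>t\<close> for \<open>B\<close>, these bounds yield
  \<open>Phi_first\<close>, \<open>Phi_two\<close> and \<open>Psi_two\<close> at \<open>p\<close>.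
  The hard case is a tail shared with \<open>A\<close>, where loads of \<open>A\<close> may carry
  \<open>B\<close> along.\<close>

lemma second_arrival:
  assumes A: "C p = {A}" and B: "B \<in> C u" "B \<notin> C p"
  shows "Phi A p \<le> tau A p" "del A B \<le> t + tau A p"
    "Phi B p \<le> 2 * t + tau A p - del A B" "Psi A B p \<le> 2 * t + tau A p - del A B / 2"
proof -
  note t0 = t_pos[OF B(1)] and BP = C_P[OF B(1)]
  note p = head_le_one(1)[OF B]
  have AP: "A \<in> P" "A \<noteq> B" using A C_P[of A p] B(2) by auto
  show PhiA: "Phi A p \<le> tau A p" by (rule Phi_one[OF p A])
  have ta: "0 \<le> tau A p" "tau A p \<le> t" using tau[OF p, of A] A by auto
  have Cu: "C u \<subseteq> {A, B}" using head_le_one(2)[OF B] A by auto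
  have del: "del A B \<le> Psi A B p" "Psi A B p \<le> Phi A p + Phi B p"
    using del_le_Psi[of A B p] Psi_le_Phi[of A B p] P_V AP BP p_V by auto
  have "Phi B p \<le> t \<or>
      (Phi B p \<le> 2 * t + tau A p - del A B \<and> Psi A B p \<le> 2 * t + tau A p - del A B / 2)"
  proof (cases "A \<in> C u")
    case False
    then have "C u = {B}" using Cu B(1) by blast
    then show ?thesis using tail_one by simp
  next
    case True
    then have u: "C u = {A, B}" using Cu B(1) by blast
    then have ucl: "u \<notin> cl" using closed_C[of u] AP by auto
    define a b where "a = tau A u" and "b = tau B u"
    have ab: "a \<le> t" "b \<le> t" using tau[OF ucl] u by (auto simp: a_def b_def)
    have diff: "C u - {A} = {B}" "C u \<noteq> {A}" "\<Union>(C u) = A \<union> B" using u AP by auto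
    have "l u p \<le> (t - b) + max 0 (tau A p - a)"
    proof (rule ccontr)
      \<comment> \<open>The second alternative of \<open>common\<close> would give
        \<open>D * t \<le> del A B \<le> 5 * t - 2 * (D * t)\<close>, that is,
        \<open>D \<le> 5 / 3\<close>.\<close>
      assume "\<not> ?thesis"
      then have "opt (insert u (insert p (A \<union> B))) - (opt A + opt B) + l u p
          \<le> c {u, p} + (5 * t - 2 * (D * t))"
        using common[OF e ucl p A True] diff AP u by (simp add: a_def b_def)
      moreover have "opt (A \<union> B) \<le> opt (insert u (insert p (A \<union> B)))"
        using P_V AP BP p_V by (intro opt_mono) auto
      moreover have "D * t \<le> opt (A \<union> B) - opt A - opt B"
        using del_Dt[OF AP(1) BP AP(2)] by (simp add: del_def)
      ultimately show False using full Dt(3)[OF t0] t0 by linarith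
    qed
    then have l: "l u p \<le> (t - b) + max 0 (tau A p - a)" .
    have Phi: "Phi B p \<le> Phi B u + l u p"
      using Phi_step[OF e] C_sub_V[OF B(1)] full by simp
    have Psi: "Psi A B p \<le> Psi A B u + l u p"
      using Psi_step[OF e] P_V[OF AP(1)] P_V[OF BP] full by simp
    have u1: "Phi B u \<le> 2 * b + a - del A B"
      using Phi_two[OF ucl B(1) True] AP(2) by (simp add: a_def b_def del_commute)
    have u2: "Psi A B u \<le> a + b + max a b - del A B / 2"
      using Psi_two[OF ucl True B(1) AP(2)] by (simp add: a_def b_def)
    show ?thesis
    proof (cases "a \<le> tau A p")
      case True
      then show ?thesis using l Phi Psi u1 u2 ab by (auto simp: max_def split: if_splits)
    next
      case False
      \<comment> \<open>As \<open>A\<close> was at \<open>p\<close> before it was at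
        \<open>u\<close>, the load is at most \<open>t - b\<close>; since the arc is full,
        \<open>lip\<close> turns this into \<open>a + b \<le> tau A p + t\<close>.\<close>
      have lip': "a \<le> tau A p + (t - b)"
        using lip[OF e ucl p, of A] \<open>A \<in> C u\<close> A l False full by (simp add: a_def)
      show ?thesis
      proof (cases "a \<le> b")
        case True
        then show ?thesis using l Phi Psi u1 u2 ab lip' False by (auto simp: max_def split: if_splits)
      next
        case False
        \<comment> \<open>\<open>B\<close> was at \<open>u\<close> before \<open>A\<close>, so its
          own loads pay for its way to \<open>u\<close> and for the arc; thus
          \<open>Phi B p \<le> t\<close>.\<close>
        then have "Phi B u \<le> b"
          using Phi_first[OF ucl B(1) \<open>A \<in> C u\<close>] by (simp add: a_def b_def)
        then show ?thesis using l Phi \<open>\<not> a \<le> tau A p\<close> by simp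
      qed
    qed
  qed
  \<comment> \<open>Attaching \<open>A\<close> and \<open>B\<close> to \<open>p\<close> separately
    bounds \<open>Psi A B p\<close> and hence \<open>del A B\<close>; if
    \<open>Phi B p \<le> t\<close>, this yields all three claims.\<close>
  then have *: "del A B \<le> t + tau A p \<and> Phi B p \<le> 2 * t + tau A p - del A B \<and>
      Psi A B p \<le> 2 * t + tau A p - del A B / 2"
    using del PhiA ta by (elim disjE) auto
  then show "del A B \<le> t + tau A p" "Phi B p \<le> 2 * t + tau A p - del A B"
    "Psi A B p \<le> 2 * t + tau A p - del A B / 2" by auto
qed

end

end

section \<open>Transitions between states\<close>

context growth_state
begin

text \<open>Newcomers at \<open>p\<close> get arrival time \<open>t\<close>, so they add nothing to
  the load sums. The cost bounds at \<open>p\<close> are collected in \<open>node_one\<close> and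
  \<open>node_two\<close>.\<close>

lemma absorb:
  assumes e: "{u, p} \<in> E" and full: "l u p = c {u, p}" and sub: "\<not> C u \<subseteq> C p"
  shows "growth_state V E c R D t P (C(p := C p \<union> C u)) l
    (\<lambda>A v. if v = p \<and> A \<notin> C p then t else tau A v) cl"
proof -
  obtain B where B: "B \<in> C u" "B \<notin> C p" using sub by blast
  note BP = C_P[OF B(1)] and t_pos = t_pos[OF e full B(1)]
  note p = head_le_one(1)[OF e full B] and pV = p_V[OF e full]
  note Dt' = Dt(1) Dt(3)[OF t_pos] t_pos
  define C' where "C' = C(p := C p \<union> C u)"
  define tau' where "tau' = (\<lambda>A v. if v = p \<and> A \<notin> C p then t else tau A v)"
  have C'_p: "C' p = C p \<union> C u" by (simp add: C'_def)
  have C'_other [simp]: "C' v = C v" if "v \<noteq> p" for v using that by (simp add: C'_def)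
  have tau'_other [simp]: "tau' A v = tau A v" if "v \<noteq> p" for A v using that by (simp add: tau'_def)
  have tau'_old: "tau' A v = tau A v" if "A \<in> C v" for A v using that by (auto simp: tau'_def)
  have tau'_new: "tau' A p = t" if "A \<notin> C p" for A using that by (simp add: tau'_def)
  have C_C': "C v \<subseteq> C' v" for v by (cases "v = p") (auto simp: C'_p)
  have new: "v = p \<and> A \<in> C u" if "A \<in> C' v" "A \<notin> C v" for A v
    using that by (cases "v = p") (auto simp: C'_p)
  have C'_P: "A \<in> P" if "A \<in> C' v" for A v using that C_P new by blast
  have tau'_bounds: "0 \<le> tau' A v \<and> tau' A v \<le> t" if "v \<notin> cl" "A \<in> C' v" for A v
  proof (cases "A \<in> C v")
    case True
    then show ?thesis using tau[OF that(1) True] tau'_old by simp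
  next
    case False
    then show ?thesis using new[OF that(2) False] tau'_new t by simp
  qed
  have sum_rest: "(\<Sum>A\<in>C' v - Z. t - tau' A v) = (\<Sum>A\<in>C v - Z. t - tau A v)" for v Z
  proof -
    have "(\<Sum>A\<in>C' v - Z. t - tau' A v) = (\<Sum>A\<in>C v - Z. t - tau' A v)"
    proof (rule sum.mono_neutral_right)
      have "C' v \<subseteq> P" using C'_P by blast
      then show "finite (C' v - Z)" using fin_P finite_subset by blast
      show "\<forall>A\<in>C' v - Z - (C v - Z). t - tau' A v = 0"
      proof
        fix A assume "A \<in> C' v - Z - (C v - Z)"
        then have "A \<in> C' v" "A \<notin> C v" by auto
        then show "t - tau' A v = 0" using new[of A v] tau'_new[of A] by simp
      qed
      show "C v - Z \<subseteq> C' v - Z" using C_C'[of v] by blast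
    qed
    also have "\<dots> = (\<Sum>A\<in>C v - Z. t - tau A v)" by (rule sum.cong) (auto simp: tau'_old)
    finally show ?thesis .
  qed
  have sum_all: "(\<Sum>A\<in>C' v. t - tau' A v) = (\<Sum>A\<in>C v. t - tau A v)" for v
    using sum_rest[of v "{}"] by simp
  have node_one: "Phi A p \<le> t" "C p = {}" "C u = {A}" if "C' p = {A}" for A
  proof -
    from that have sub: "C p \<subseteq> {A}" "C u \<subseteq> {A}" by (auto simp: C'_p)
    then have "B = A" using B(1) by blast
    then show Cp: "C p = {}" and Cu: "C u = {A}" using sub B by auto
    then show "Phi A p \<le> t" using tail_one[OF e full] by simp
  qed
  have node_two: "Phi A p \<le> 2 * tau' A p + tau' X p - del A X \<and>
      Psi A X p \<le> tau' A p + tau' X p + max (tau' A p) (tau' X p) - del A X / 2 \<and>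
      (tau' A p < tau' X p \<longrightarrow> Phi A p \<le> tau' A p)"
    if AX: "A \<in> C' p" "X \<in> C' p" "A \<noteq> X" for A X
  proof (cases "C p = {}")
    case True
    then have "A \<in> C u" "X \<in> C u" using AX by (auto simp: C'_p)
    then have "C u = {A, X}" using AX(3) two[of A u X] by blast
    then show ?thesis
      using tail_two[OF e full AX(3)] True tau'_new by auto
  next
    case False
    then obtain Y where Y: "C p = {Y}" "C u \<subseteq> {Y, B}" using head_le_one(2)[OF e full B] by blast
    then have YB: "Y \<noteq> B" "tau' Y p = tau Y p" "tau' B p = t" "tau Y p \<le> t"
      using B tau'_old tau'_new tau[OF p, of Y] by auto
    have "(A = Y \<and> X = B) \<or> (A = B \<and> X = Y)" using AX Y by (auto simp: C'_p)
    then show ?thesis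
      using second_arrival[OF e full Y(1) B] YB
      by (auto simp: del_commute Psi_commute max_def)
  qed
  have "growth_state V E c R D t P C' l tau' cl"
  proof
    show "12 / 7 < D" "D \<le> 2" "tight_partition P" "separated (D * t) P" "0 \<le> t"
      by (fact D tp sep t)+
    show "S \<in> P" if "S \<in> C' v" for S v using that by (rule C'_P)
    show "v \<in> V" if "S \<in> C' v" for S v
      using C_V[of S v] new[OF that] pV(1) by auto
    show "S \<in> C' s" if "S \<in> P" "s \<in> S" for S s
      using own[OF that] C_C'[of s] by blast
    show "s \<in> S" if sR: "s \<in> R" and S: "S \<in> C' s" for s S
    proof (rule ccontr)
      \<comment> \<open>A terminal costs its own component nothing, so a foreign arrival would give
        \<open>D * t \<le> del Z S \<le> 3 * t - D * t\<close>, that is,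
        \<open>D \<le> 3 / 2\<close>.\<close>
      assume s: "s \<notin> S"
      then have "S \<notin> C s" using own_only[OF sR] by blast
      then have sp: "s = p" "S \<in> C u" using new[OF S] by auto
      obtain Z where Z: "Z \<in> P" "s \<in> Z" using sR part by (auto simp: partition_def)
      then have "insert s Z = Z" by blast
      then have "Phi Z s = 0" by (simp add: Phi_def)
      moreover have "D * t \<le> del Z S" using del_Dt[OF Z(1) C_P[OF sp(2)]] Z(2) s by blast
      moreover have "del Z S \<le> Phi Z s + Phi S s"
        using del_le_Psi[of Z S s] Psi_le_Phi[of Z S s] P_V[OF Z(1)] C_sub_V[OF sp(2)] sR graph(5) by force
      moreover have "Phi S s \<le> 3 * t - D * t" using tail_crude[OF e full sp(2)] sp by simp
      ultimately show False using Dt' by simp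
    qed
    show "\<exists>X. C' v = {X}" if "v \<in> cl" for v using that p closed_C[OF that] by (cases "v = p") auto
    show "A = B' \<or> A = X \<or> B' = X" if "A \<in> C' v" "B' \<in> C' v" "X \<in> C' v" for A B' X v
    proof (cases "v = p")
      case False
      then show ?thesis using that two by simp
    next
      case True
      show ?thesis
      proof (cases "C p = {}")
        case Cp: True
        then show ?thesis using that two[of A u B' X] True by (simp add: C'_p)
      next
        case False
        then obtain Y where "C p = {Y}" "C u \<subseteq> {Y, B}" using head_le_one(2)[OF e full B] by blast
        then have "C' p \<subseteq> {Y, B}" unfolding C'_p by simp
        then show ?thesis using that True by blast
      qed
    qed
    show "0 \<le> tau' A v \<and> tau' A v \<le> t" if "v \<notin> cl" "A \<in> C' v" for A v
      using that by (rule tau'_bounds)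
    show "Phi A v \<le> tau' A v" if "v \<notin> cl" "C' v = {A}" for v A
    proof (cases "v = p")
      case True
      then show ?thesis using node_one[of A] that(2) tau'_new[of A] by auto
    qed (use that Phi_one in simp)
    show "Phi A v \<le> tau' A v"
      if "v \<notin> cl" "A \<in> C' v" "X \<in> C' v" "tau' A v < tau' X v" for v A X
    proof (cases "v = p")
      case True
      then show ?thesis using node_two[of A X] that by auto
    qed (use that Phi_first in auto)
    show "Phi A v \<le> 2 * tau' A v + tau' X v - del A X"
      if "v \<notin> cl" "A \<in> C' v" "X \<in> C' v" "A \<noteq> X" for v A X
    proof (cases "v = p")
      case True
      then show ?thesis using node_two[of A X] that by auto
    qed (use that Phi_two in auto)
    show "Psi A X v \<le> tau' A v + tau' X v + max (tau' A v) (tau' X v) - del A X / 2"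
      if "v \<notin> cl" "A \<in> C' v" "X \<in> C' v" "A \<noteq> X" for v A X
    proof (cases "v = p")
      case True
      then show ?thesis using node_two[of A X] that by auto
    qed (use that Psi_two in auto)
    show "Phi X v \<le> 3 * t - 3 / 2 * (D * t)" if "v \<in> cl" "X \<in> C' v" for v X
      using that p closed by (cases "v = p") auto
    show "Phi X v + l v w \<le> t" if "v \<in> cl" "X \<in> C' v" "{v, w} \<in> E" for v w X
      using that p closed_arc by (cases "v = p") auto
    show "0 \<le> l v w" if "{v, w} \<in> E" for v w using that by (rule l_nonneg)
    show "l v w \<le> c {v, w}" if "{v, w} \<in> E" for v w using that by (rule l_cap)
    show "l v w \<le> (\<Sum>A\<in>C' v. t - tau' A v)" if "{v, w} \<in> E" "v \<notin> cl" for v w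
      using l_up[OF that] sum_all by simp
    show "t - tau' A v \<le> l v w"
      if vw: "{v, w} \<in> E" "v \<notin> cl" "A \<in> C' v" "A \<notin> C' w" for v w A
    proof (cases "A \<in> C v")
      case True
      then show ?thesis using l_lo[OF vw(1,2) True] vw(4) C_C' tau'_old by auto
    next
      case False
      then show ?thesis using new[OF vw(3) False] tau'_new l_nonneg[OF vw(1)] by simp
    qed
    show "tau' A v \<le> tau' A w + c {v, w}"
      if vw: "{v, w} \<in> E" "v \<notin> cl" "w \<notin> cl" "A \<in> C' v" "A \<in> C' w" for v w A
    proof -
      have c: "0 < c {v, w}" using c_pos vw(1) .
      consider "A \<in> C v" "A \<in> C w" | "A \<notin> C v" "A \<in> C w" | "A \<notin> C w" by blast
      then show ?thesis
      proof cases
        case 1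
        then show ?thesis using lip[OF vw(1-3) 1] tau'_old by simp
      next
        case 2
        \<comment> \<open>\<open>A\<close> has loaded the reverse arc since \<open>tau A w\<close>,
          so the elapsed time is at most the cost of the edge.\<close>
        have wv: "{w, v} \<in> E" using vw(1) by (simp add: insert_commute)
        have "t - tau A w \<le> c {w, v}"
          using l_lo[OF wv vw(3) 2(2,1)] l_cap[OF wv] by simp
        then show ?thesis
          using tau'_bounds[OF vw(2,4)] tau'_old[OF 2(2)] by (simp add: insert_commute)
      next
        case 3
        then have "tau' A w = t" using new[OF vw(5) 3] tau'_new by simp
        then show ?thesis using tau'_bounds[OF vw(2,4)] c by simp
      qed
    qed
    show "l v w \<le> (\<Sum>A\<in>C' v - {X}. t - tau' A v) + max 0 (tau' X w - tau' X v) \<or>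
        opt (insert v (insert w (\<Union>(C' v)))) - (\<Sum>A\<in>C' v. opt A) + l v w
          \<le> c {v, w} + (if C' v = {X} then 2 * t - D * t else 5 * t - 2 * (D * t))"
      if vw: "{v, w} \<in> E" "v \<notin> cl" "w \<notin> cl" "C' w = {X}" "X \<in> C' v" for v w X
    proof (cases "w = p")
      case True
      then have v: "v \<noteq> p" using edge_card[OF vw(1)] by auto
      then have X: "X \<in> C v" using vw(5) by simp
      \<comment> \<open>As \<open>X\<close> reaches \<open>w\<close> only now, the
        \<open>max\<close> term equals its whole share \<open>t - tau X v\<close> in
        \<open>l_up\<close>.\<close>
      have "tau' X w = t" using node_one(2)[of X] vw(4) True tau'_new by simp
      moreover have "l v w \<le> (t - tau X v) + (\<Sum>A\<in>C v - {X}. t - tau A v)"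
        using l_up[OF vw(1,2)] sum.remove[OF fin_C X, of "\<lambda>A. t - tau A v"] by simp
      ultimately have "l v w \<le> (\<Sum>A\<in>C' v - {X}. t - tau' A v) + max 0 (tau' X w - tau' X v)"
        using v by (simp add: max_def)
      then show ?thesis by (rule disjI1)
    next
      case w: False
      then have Cw: "C w = {X}" using vw(4) by simp
      show ?thesis
      proof (cases "X \<in> C v")
        case False
        then have "C v - {X} = C v" by blast
        then have "l v w \<le> (\<Sum>A\<in>C' v - {X}. t - tau' A v) + max 0 (tau' X w - tau' X v)"
          using l_up[OF vw(1,2)] sum_rest[of v "{X}"] by simp
        then show ?thesis by (rule disjI1)
      next
        case True
        note common = common[OF vw(1-3) Cw True]
        have tau'_eq: "tau' X w = tau X w" "tau' X v = tau X v"
          using tau'_other[OF w] tau'_old[OF True] by simp_all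
        show ?thesis
        proof (cases "v = p")
          case False
          then show ?thesis using common tau'_eq by simp
        next
          case vp: True
          have Xp: "X \<in> C p" using True vp by simp
          then obtain Y where Y: "C p = {Y}" "C u \<subseteq> {Y, B}"
            using head_le_one(2)[OF e full B] by blast
          then have "Y = X" using Xp by simp
          with Y have Cp: "C p = {X}" "C u \<subseteq> {X, B}" by simp_all
          then have XB: "X \<noteq> B" "C' p = {X, B}" using B by (auto simp: C'_p)
          have XV: "X \<subseteq> V" "B \<subseteq> V" "w \<in> V" using C_sub_V[OF True] C_sub_V[OF B(1)] edge_in_V(2)[OF vw(1)] by simp_all
          have "opt (insert p (insert w (X \<union> B))) \<le> opt (insert p (insert w X)) + opt (insert p B)"
            using opt_Un[of "insert p (insert w X)" "insert p B"] XV pV by simp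
          \<comment> \<open>A second component raises the excess by at most
            \<open>3 * t - D * t\<close>. This leads from \<open>2 * t - D * t\<close> to the other
            constant of \<open>common\<close>, \<open>5 * t - 2 * (D * t)\<close>.\<close>
          moreover have "opt (insert p B) - opt B \<le> 3 * t - D * t"
            using tail_crude[OF e full B(1)] by (simp add: Phi_def)
          ultimately have le: "opt (insert p (insert w (X \<union> B))) - (opt X + opt B)
              \<le> opt (insert p (insert w X)) - opt X + (3 * t - D * t)" by simp
          from common show ?thesis
          proof
            assume "l v w \<le> (\<Sum>A\<in>C v - {X}. t - tau A v) + max 0 (tau X w - tau X v)"
            then have "l v w \<le> (\<Sum>A\<in>C' v - {X}. t - tau' A v) + max 0 (tau' X w - tau' X v)"
              by (simp only: sum_rest tau'_eq)
            then show ?thesis by (rule disjI1)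
          next
            assume "opt (insert v (insert w (\<Union>(C v)))) - (\<Sum>A\<in>C v. opt A) + l v w
              \<le> c {v, w} + (if C v = {X} then 2 * t - D * t else 5 * t - 2 * (D * t))"
            then have "opt (insert p (insert w X)) - opt X + l p w \<le> c {p, w} + (2 * t - D * t)"
              using Cp(1) vp by simp
            then have "opt (insert p (insert w (X \<union> B))) - (opt X + opt B) + l p w
              \<le> c {p, w} + (5 * t - 2 * (D * t))" using le by linarith
            moreover have "\<Union>(C' p) = X \<union> B" "(\<Sum>A\<in>C' p. opt A) = opt X + opt B" "C' p \<noteq> {X}"
              using XB by auto
            ultimately show ?thesis unfolding vp by simp
          qed
        qed
      qed
    qed
  qed
  then show ?thesis unfolding C'_def tau'_def .
qed


text \<open>Only time and loads change, so the invariants reduce to comparisons of growth rates;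
  those with \<open>D * t\<close> on the right use \<open>D \<le> 2\<close>.\<close>

lemma advance:
  assumes s: "0 \<le> s" and sep': "separated (D * (t + s)) P"
    and cap: "\<And>v w. {v, w} \<in> E \<Longrightarrow> l v w + s * real (card (C v - C w)) \<le> c {v, w}"
  shows "growth_state V E c R D (t + s) P C (\<lambda>v w. l v w + s * real (card (C v - C w))) tau cl"
proof -
  have Ds: "12 / 7 * s \<le> D * s" "D * s \<le> 2 * s"
    using mult_right_mono[OF less_imp_le[OF D(1)] s] mult_right_mono[OF D(2) s] by simp_all
  have dist: "D * (t + s) = D * t + D * s" by (simp add: algebra_simps)
  have sum: "(\<Sum>A\<in>C v - Z. t + s - tau A v) = (\<Sum>A\<in>C v - Z. t - tau A v) + s * real (card (C v - Z))"
    for v Z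
    by (simp add: sum_subtractf algebra_simps)
  have mono: "s * real (card (C v - Z)) \<le> s * real (card (C v))" for v Z
    using s fin_C by (intro mult_left_mono) (auto intro: card_mono)
  show ?thesis
  proof
    show "12 / 7 < D" "D \<le> 2" "tight_partition P" "separated (D * (t + s)) P" by (fact D tp sep')+
    show "0 \<le> t + s" using t s by simp
    show "S \<in> P" "v \<in> V" if "S \<in> C v" for S v using C_P[OF that] C_V[OF that] by simp_all
    show "S \<in> C s" if "S \<in> P" "s \<in> S" for S s using own[OF that] .
    show "s \<in> S" if "s \<in> R" "S \<in> C s" for S s using own_only[OF that] .
    show "\<exists>X. C v = {X}" if "v \<in> cl" for v using closed_C[OF that] .
    show "A = B \<or> A = X \<or> B = X" if "A \<in> C v" "B \<in> C v" "X \<in> C v" for A B X v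
      using two[OF that] .
    show "0 \<le> tau A v \<and> tau A v \<le> t + s" if "v \<notin> cl" "A \<in> C v" for A v
      using tau[OF that] s by simp
    show "Phi A v \<le> tau A v" if "v \<notin> cl" "C v = {A}" for A v using Phi_one[OF that] .
    show "Phi A v \<le> tau A v" if "v \<notin> cl" "A \<in> C v" "B \<in> C v" "tau A v < tau B v" for A B v
      using Phi_first[OF that] .
    show "Phi A v \<le> 2 * tau A v + tau B v - del A B"
      if "v \<notin> cl" "A \<in> C v" "B \<in> C v" "A \<noteq> B" for A B v using Phi_two[OF that] .
    show "Psi A B v \<le> tau A v + tau B v + max (tau A v) (tau B v) - del A B / 2"
      if "v \<notin> cl" "A \<in> C v" "B \<in> C v" "A \<noteq> B" for A B v using Psi_two[OF that] .
    show "Phi X v \<le> 3 * (t + s) - 3 / 2 * (D * (t + s))" if "v \<in> cl" "X \<in> C v" for X v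
      using closed[OF that] Ds unfolding dist distrib_left by linarith
    show "Phi X v + (l v w + s * real (card (C v - C w))) \<le> t + s"
      if "v \<in> cl" "X \<in> C v" "{v, w} \<in> E" for X v w
    proof -
      obtain Y where Y: "C v = {Y}" using closed_C[OF \<open>v \<in> cl\<close>] by blast
      have "s * real (card (C v - C w)) \<le> s * 1"
        using mono[of v "C w"] Y by simp
      then show ?thesis using closed_arc[OF that] by simp
    qed
    show "0 \<le> l v w + s * real (card (C v - C w))" if "{v, w} \<in> E" for v w
      using l_nonneg[OF that] s by simp
    show "l v w + s * real (card (C v - C w)) \<le> c {v, w}" if "{v, w} \<in> E" for v w
      using cap[OF that] .
    show "l v w + s * real (card (C v - C w)) \<le> (\<Sum>A\<in>C v. t + s - tau A v)"
      if "{v, w} \<in> E" "v \<notin> cl" for v w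
      using l_up[OF that] sum[of v "{}"] mono[of v "C w"] by simp
    show "t + s - tau A v \<le> l v w + s * real (card (C v - C w))"
      if "{v, w} \<in> E" "v \<notin> cl" "A \<in> C v" "A \<notin> C w" for v w A
    proof -
      have "1 \<le> card (C v - C w)"
        using that(3,4) fin_C[of v] by (metis DiffI One_nat_def Suc_leI card_gt_0_iff empty_iff finite_Diff)
      then have "s * 1 \<le> s * real (card (C v - C w))" using s by (intro mult_left_mono) auto
      then show ?thesis using l_lo[OF that] by simp
    qed
    show "tau A v \<le> tau A w + c {v, w}"
      if "{v, w} \<in> E" "v \<notin> cl" "w \<notin> cl" "A \<in> C v" "A \<in> C w" for v w A
      using lip[OF that] .
    show "l v w + s * real (card (C v - C w))
          \<le> (\<Sum>A\<in>C v - {X}. t + s - tau A v) + max 0 (tau X w - tau X v) \<or>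
        opt (insert v (insert w (\<Union>(C v)))) - (\<Sum>A\<in>C v. opt A) + (l v w + s * real (card (C v - C w)))
          \<le> c {v, w} + (if C v = {X} then 2 * (t + s) - D * (t + s)
              else 5 * (t + s) - 2 * (D * (t + s)))"
      if vw: "{v, w} \<in> E" "v \<notin> cl" "w \<notin> cl" "C w = {X}" "X \<in> C v" for v w X
    proof -
      \<comment> \<open>Only a second component at \<open>v\<close> loads this arc. Its unit rate is
        covered by \<open>5 - 2 * D \<ge> 1\<close>; without it, \<open>2 - D \<ge> 0\<close>
        suffices.\<close>
      have card: "s * real (card (C v - C w)) \<le> (if C v = {X} then 0 else s)"
      proof (cases rule: C_cases[of v])
        case (3 A B)
        then show ?thesis using vw(4,5) s by (auto simp: insert_Diff_if)
      qed (use vw s in auto)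
      from common[OF vw] show ?thesis
      proof
        assume "l v w \<le> (\<Sum>A\<in>C v - {X}. t - tau A v) + max 0 (tau X w - tau X v)"
        then have "l v w + s * real (card (C v - C w))
          \<le> (\<Sum>A\<in>C v - {X}. t + s - tau A v) + max 0 (tau X w - tau X v)"
          using sum[of v "{X}"] vw(4) by simp
        then show ?thesis by (rule disjI1)
      next
        assume "opt (insert v (insert w (\<Union>(C v)))) - (\<Sum>A\<in>C v. opt A) + l v w
          \<le> c {v, w} + (if C v = {X} then 2 * t - D * t else 5 * t - 2 * (D * t))"
        then have "opt (insert v (insert w (\<Union>(C v)))) - (\<Sum>A\<in>C v. opt A)
            + (l v w + s * real (card (C v - C w)))
          \<le> c {v, w} + (if C v = {X} then 2 * (t + s) - D * (t + s)
              else 5 * (t + s) - 2 * (D * (t + s)))"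
          using card Ds s unfolding dist by (auto split: if_splits)
        then show ?thesis by (rule disjI2)
      qed
    qed
  qed
qed


text \<open>\<open>f\<close> renames both parts to their union, and a vertex with both parts enters
  \<open>cl\<close>. At any other vertex at most one part is present, so \<open>f\<close> is
  injective there and arrival times carry over.\<close>

lemma merge:
  assumes AB: "A \<in> P" "B \<in> P" "A \<noteq> B" and xy: "x \<in> A" "y \<in> B" "dist {x, y} = D * t"
  defines "f \<equiv> \<lambda>S. if S = A \<or> S = B then A \<union> B else S"
  shows "growth_state V E c R D t (join A B P) (\<lambda>v. f ` C v) l
    (\<lambda>S v. if S = A \<union> B then (if A \<in> C v then tau A v else tau B v) else tau S v)
    (cl \<union> {v. A \<in> C v \<and> B \<in> C v})"
proof -
  define J where "J = A \<union> B"
  define tau' where "tau' = (\<lambda>S v. if S = J then (if A \<in> C v then tau A v else tau B v) else tau S v)"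
  define cl' where "cl' = cl \<union> {v. A \<in> C v \<and> B \<in> C v}"
  note JP = join_notin[OF part AB, folded J_def]
  note tp' = tight_partition_join[OF tp sep AB xy, folded J_def]
  have V: "A \<subseteq> V" "B \<subseteq> V" using P_V AB by simp_all
  have f_A: "f A = J" "f B = J" by (simp_all add: f_def J_def)
  have f_other: "f S = S" if "S \<noteq> A" "S \<noteq> B" for S using that by (simp add: f_def)
  have f_sub: "S \<subseteq> f S" for S by (auto simp: f_def)
  have f_eq: "S = T \<or> {S, T} = {A, B}" if "f S = f T" "S \<in> P" "T \<in> P" for S T
    using that JP by (auto simp: f_def J_def split: if_splits)
  have f_inj: "inj_on f (C v)" if "v \<notin> cl'" for v
  proof (rule inj_onI)
    fix S T assume "S \<in> C v" "T \<in> C v" "f S = f T"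
    then show "S = T" using f_eq[of S T] C_P that by (auto simp: cl'_def doubleton_eq_iff)
  qed
  have f_single: "C v = {T}" if v: "v \<notin> cl'" and T: "T \<in> C v" "f ` C v = {f T}" for v T
  proof -
    have "S = T" if "S \<in> C v" for S
    proof (rule inj_onD[OF f_inj[OF v] _ that T(1)])
      show "f S = f T" using imageI[OF that, of f] T(2) by simp
    qed
    then show ?thesis using T(1) by blast
  qed
  have tau'_f: "tau' (f S) v = tau S v" if "v \<notin> cl'" "S \<in> C v" for S v
    using that C_P[OF that(2)] JP by (auto simp: tau'_def f_def cl'_def J_def)
  have sum_f: "(\<Sum>S\<in>f ` C v - f ` Z. t - tau' S v) = (\<Sum>S\<in>C v - Z. t - tau S v)"
    if "v \<notin> cl'" "Z \<subseteq> C v" for v Z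
  proof -
    have "f ` C v - f ` Z = f ` (C v - Z)"
      using inj_on_image_set_diff[OF f_inj[OF that(1)], of "C v" Z] that(2) by auto
    moreover have "inj_on f (C v - Z)" using f_inj[OF that(1)] inj_on_diff by blast
    ultimately show ?thesis
      using tau'_f[OF that(1)] by (simp add: sum.reindex)
  qed
  \<comment> \<open>Renaming never increases an excess: the missing part \<open>Y\<close> can be
    attached for \<open>opt Y + D * t\<close>, exactly the growth of the subtracted optima. The set
    \<open>W\<close> adapts this to \<open>Phi\<close>, \<open>Psi\<close>, \<open>del\<close> and
    the trees in \<open>common\<close>.\<close>
  have merge_le: "opt (W \<union> \<Union>(f ` Q)) - (\<Sum>S\<in>f ` Q. opt S) \<le> opt (W \<union> \<Union>Q) - (\<Sum>S\<in>Q. opt S)"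
    if W: "W \<subseteq> V" and Q: "Q \<subseteq> P" "\<not> (A \<in> Q \<and> B \<in> Q)" for W Q
  proof -
    have fin: "finite Q" using Q(1) fin_P finite_subset by blast
    have QV: "\<Union>Q \<subseteq> V" using Q(1) P_V by blast
    have JQ: "J \<notin> Q" using Q(1) JP by blast
    have *: "?thesis" if X: "X \<in> Q" "Y \<notin> Q" "X \<union> Y = J" "f X = J" "\<And>S. S \<in> Q \<Longrightarrow> S \<noteq> X \<Longrightarrow> f S = S"
      "opt ((W \<union> \<Union>Q) \<union> Y) \<le> opt (W \<union> \<Union>Q) + opt Y + D * t" "opt J = opt X + opt Y + D * t" for X Y
    proof -
      have fQ: "f ` Q = insert J (Q - {X})"
      proof -
        have "f ` (Q - {X}) = Q - {X}" using X(5) by force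
        moreover have "f ` Q = insert (f X) (f ` (Q - {X}))" using X(1) by blast
        ultimately show ?thesis using X(4) by simp
      qed
      have "(\<Sum>S\<in>f ` Q. opt S) = opt J + (\<Sum>S\<in>Q - {X}. opt S)"
        unfolding fQ using fin JQ by (subst sum.insert) auto
      also have "\<dots> = (\<Sum>S\<in>Q. opt S) + opt Y + D * t"
        using sum.remove[OF fin X(1), of opt] X(7) by simp
      finally have "(\<Sum>S\<in>f ` Q. opt S) = (\<Sum>S\<in>Q. opt S) + opt Y + D * t" .
      moreover have "W \<union> \<Union>(f ` Q) = (W \<union> \<Union>Q) \<union> Y"
        unfolding fQ X(3)[symmetric] using X(1) by blast
      ultimately show ?thesis using X(6) by simp
    qed
    consider "A \<in> Q" "B \<notin> Q" | "B \<in> Q" "A \<notin> Q" | "A \<notin> Q" "B \<notin> Q" using Q(2) by blast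
    then show ?thesis
    proof cases
      case 1
      have "opt ((W \<union> \<Union>Q) \<union> B) \<le> opt (W \<union> \<Union>Q) + opt B + D * t"
        using opt_join_le[OF xy(1,2), of "W \<union> \<Union>Q"] 1 W QV V xy(3) by auto
      then show ?thesis
        using *[of A B] 1 f_A f_other tp'(2) by (metis J_def)
    next
      case 2
      have "opt ((W \<union> \<Union>Q) \<union> A) \<le> opt (W \<union> \<Union>Q) + opt A + D * t"
        using opt_join_le[OF xy(2,1), of "W \<union> \<Union>Q"] 2 W QV V xy(3) by (auto simp: insert_commute)
      moreover have "opt J = opt B + opt A + D * t" using tp'(2) by simp
      ultimately show ?thesis
        using *[of B A] 2 f_A f_other by (metis J_def Un_commute)
    next
      case 3
      then have "f S = S" if "S \<in> Q" for S using that f_other[of S] by blast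
      then have "f ` Q = Q" by force
      then show ?thesis by simp
    qed
  qed
  have Phi_f: "Phi (f S) v \<le> Phi S v" if "S \<in> P" "v \<in> V" for S v
    using merge_le[of "{v}" "{S}"] that AB by (auto simp: Phi_def)
  \<comment> \<open>A smaller \<open>del\<close> only weakens the invariants, since they subtract
    it.\<close>
  have pair_f: "Psi (f S) (f T) v \<le> Psi S T v" "del (f S) (f T) \<le> del S T"
    if "S \<in> P" "T \<in> P" "S \<noteq> T" "f S \<noteq> f T" "v \<in> V" for S T v
  proof -
    have "\<not> (A \<in> {S, T} \<and> B \<in> {S, T})" using that AB f_A by auto
    then show "Psi (f S) (f T) v \<le> Psi S T v" "del (f S) (f T) \<le> del S T"
      using merge_le[of "{v}" "{S, T}"] merge_le[of "{}" "{S, T}"] that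
      by (auto simp: Psi_def del_def)
  qed
  have not_both: "\<not> (A \<in> C v \<and> B \<in> C v)" "v \<notin> cl" if "v \<notin> cl'" for v
    using that by (auto simp: cl'_def)
  have C_V': "v \<in> V" "C v \<subseteq> P" if "S \<in> C v" for S v using C_V[OF that] C_P by auto
  have both: "C v = {A, B}" "v \<notin> cl" if "A \<in> C v" "B \<in> C v" for v
  proof -
    show "C v = {A, B}" using two[OF that] that AB(3) by blast
    then show "v \<notin> cl" using closed_C[of v] AB(3) by auto
  qed
  have "growth_state V E c R D t (join A B P) (\<lambda>v. f ` C v) l tau' cl'"
  proof
    show "12 / 7 < D" "D \<le> 2" "0 \<le> t" by (fact D t)+
    show "tight_partition (join A B P)" by (rule tp'(1))
    show "separated (D * t) (join A B P)" by (rule separated_join[OF sep AB(1,2)])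
    show "S \<in> join A B P" "v \<in> V" if "S \<in> f ` C v" for S v
    proof -
      from that obtain X where X: "X \<in> C v" "S = f X" by blast
      then show "S \<in> join A B P" "v \<in> V"
        using C_P[OF X(1)] C_V[OF X(1)] by (auto simp: join_def f_def)
    qed
    show "S \<in> f ` C s" if "S \<in> join A B P" "s \<in> S" for S s
    proof -
      from that(1) consider "S = J" | "S \<in> P" "S \<noteq> A" "S \<noteq> B" by (auto simp: join_def J_def)
      then show ?thesis
      proof cases
        case 1
        then have "A \<in> C s \<or> B \<in> C s"
          using that(2) own[OF AB(1), of s] own[OF AB(2), of s] by (auto simp: J_def)
        then show ?thesis using 1 f_A by (metis imageI)
      next
        case 2
        then show ?thesis using imageI[OF own[OF 2(1) that(2)], of f] f_other[OF 2(2,3)] by simp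
      qed
    qed
    show "s \<in> S" if "s \<in> R" "S \<in> f ` C s" for S s
    proof -
      from that(2) obtain X where X: "X \<in> C s" "S = f X" by blast
      then show ?thesis using own_only[OF that(1) X(1)] f_sub[of X] by blast
    qed
    show "\<exists>X. f ` C v = {X}" if "v \<in> cl'" for v
    proof (cases "v \<in> cl")
      case True
      then show ?thesis using closed_C[of v] by force
    next
      case False
      then have "C v = {A, B}" using that both(1)[of v] by (auto simp: cl'_def)
      then show ?thesis using f_A by simp
    qed
    show "S = T \<or> S = X \<or> T = X"
      if "S \<in> f ` C v" "T \<in> f ` C v" "X \<in> f ` C v" for S T X v
    proof -
      from that obtain S' T' X' where "S' \<in> C v" "T' \<in> C v" "X' \<in> C v" "S = f S'" "T = f T'" "X = f X'"
        by blast
      then show ?thesis using two[of S' v T' X'] by auto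
    qed
    show "0 \<le> tau' S v \<and> tau' S v \<le> t" if v: "v \<notin> cl'" and S: "S \<in> f ` C v" for S v
      using S tau'_f[OF v] tau[OF not_both(2)[OF v]] by auto
    show "Phi S v \<le> tau' S v" if v: "v \<notin> cl'" and S: "f ` C v = {S}" for v S
    proof -
      from S obtain T where T: "T \<in> C v" "S = f T" by blast
      have "C v = {T}"
        using S T f_single[OF v T(1)] by simp
      then show ?thesis
        using Phi_one[OF not_both(2)[OF v]] Phi_f[of T v] T tau'_f[OF v] C_P C_V by force
    qed
    show "Phi S v \<le> tau' S v"
      if v: "v \<notin> cl'" and ST: "S \<in> f ` C v" "T \<in> f ` C v" "tau' S v < tau' T v" for v S T
    proof -
      from ST obtain X Y where XY: "X \<in> C v" "S = f X" "Y \<in> C v" "T = f Y" by blast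
      then have "tau X v < tau Y v" using ST(3) tau'_f[OF v] by simp
      then show ?thesis
        using Phi_first[OF not_both(2)[OF v] XY(1,3)] Phi_f[OF C_P[OF XY(1)] C_V[OF XY(1)]]
          XY tau'_f[OF v XY(1)] by simp
    qed
    show "Phi S v \<le> 2 * tau' S v + tau' T v - del S T"
      "Psi S T v \<le> tau' S v + tau' T v + max (tau' S v) (tau' T v) - del S T / 2"
      if v: "v \<notin> cl'" and ST: "S \<in> f ` C v" "T \<in> f ` C v" "S \<noteq> T" for v S T
    proof -
      from ST obtain X Y where XY: "X \<in> C v" "S = f X" "Y \<in> C v" "T = f Y" by blast
      then have ne: "X \<noteq> Y" "f X \<noteq> f Y" using ST(3) by auto
      note xy = C_P[OF XY(1)] C_P[OF XY(3)] C_V[OF XY(1)]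
      note le = pair_f[OF xy(1,2) ne xy(3)] Phi_f[OF xy(1,3)]
      note eqs = XY(2,4) tau'_f[OF v XY(1)] tau'_f[OF v XY(3)]
      show "Phi S v \<le> 2 * tau' S v + tau' T v - del S T"
        using Phi_two[OF not_both(2)[OF v] XY(1,3) ne(1)] le unfolding eqs by simp
      show "Psi S T v \<le> tau' S v + tau' T v + max (tau' S v) (tau' T v) - del S T / 2"
        using Psi_two[OF not_both(2)[OF v] XY(1,3) ne(1)] le unfolding eqs by simp
    qed
    \<comment> \<open>The optimum of \<open>J\<close> already contains the link of length
      \<open>D * t\<close>. Together with half of \<open>del A B\<close> from \<open>Psi_two\<close>
      this makes the term \<open>3 / 2 * (D * t)\<close> in \<open>closed\<close>.\<close>
    have Phi_J: "Phi J v = Psi A B v - D * t" for v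
      using tp'(2) by (simp add: Phi_def Psi_def J_def)
    have Phi_J_le: "Phi J v \<le> tau A v + tau B v + max (tau A v) (tau B v) - 3 / 2 * (D * t)"
      if "A \<in> C v" "B \<in> C v" for v
      using Psi_two[OF both(2)[OF that] that AB(3)] Phi_J[of v] del_Dt[OF AB] by simp
    show "Phi S v \<le> 3 * t - 3 / 2 * (D * t)" if v: "v \<in> cl'" and S: "S \<in> f ` C v" for v S
    proof (cases "v \<in> cl")
      case True
      from S obtain X where "X \<in> C v" "S = f X" by blast
      then show ?thesis using closed[OF True, of X] Phi_f[of X v] C_P C_V by force
    next
      case False
      then have ab: "A \<in> C v" "B \<in> C v" using v by (auto simp: cl'_def)
      then have "S = J" using S both(1)[OF ab] f_A by auto
      moreover have "max (tau A v) (tau B v) \<le> t" "tau A v \<le> t" "tau B v \<le> t"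
        using tau[OF False ab(1)] tau[OF False ab(2)] by simp_all
      then have "Phi J v \<le> 3 * t - 3 / 2 * (D * t)" using Phi_J_le[OF ab] by linarith
      ultimately show ?thesis by simp
    qed
    show "Phi S v + l v w \<le> t" if v: "v \<in> cl'" and S: "S \<in> f ` C v" and e: "{v, w} \<in> E" for v w S
    proof (cases "v \<in> cl")
      case True
      from S obtain X where "X \<in> C v" "S = f X" by blast
      then show ?thesis using closed_arc[OF True, of X w] e Phi_f[of X v] C_P C_V by force
    next
      case False
      then have ab: "A \<in> C v" "B \<in> C v" using v by (auto simp: cl'_def)
      then have "S = J" using S both(1)[OF ab] f_A by auto
      have "l v w \<le> 2 * t - tau A v - tau B v"
        using l_up[OF e False] both(1)[OF ab] AB(3) by simp
      moreover have "max (tau A v) (tau B v) \<le> t" "0 \<le> t"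
        using tau[OF False ab(1)] tau[OF False ab(2)] by simp_all
      \<comment> \<open>The arrival times of both parts cancel; what remains is at most
        \<open>3 * t - 3 / 2 * (D * t)\<close>, hence at most \<open>3 / 7 * t\<close>.\<close>
      ultimately have "Phi J v + l v w \<le> t" using Phi_J_le[OF ab] Dt by linarith
      with \<open>S = J\<close> show ?thesis by simp
    qed
    show "0 \<le> l v w" "l v w \<le> c {v, w}" if "{v, w} \<in> E" for v w
      using l_nonneg[OF that] l_cap[OF that] by simp_all
    show "l v w \<le> (\<Sum>S\<in>f ` C v. t - tau' S v)" if "{v, w} \<in> E" "v \<notin> cl'" for v w
      using l_up[OF that(1) not_both(2)[OF that(2)]] sum_f[OF that(2), of "{}"] by simp
    show "t - tau' S v \<le> l v w"
      if e: "{v, w} \<in> E" and v: "v \<notin> cl'" and S: "S \<in> f ` C v" "S \<notin> f ` C w" for v w S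
    proof -
      from S obtain X where X: "X \<in> C v" "S = f X" "X \<notin> C w" by blast
      then show ?thesis using l_lo[OF e not_both(2)[OF v] X(1,3)] tau'_f[OF v X(1)] by simp
    qed
    show "tau' S v \<le> tau' S w + c {v, w}"
      if e: "{v, w} \<in> E" and vw: "v \<notin> cl'" "w \<notin> cl'" and S: "S \<in> f ` C v" "S \<in> f ` C w" for v w S
    proof -
      from S obtain X Y where XY: "X \<in> C v" "S = f X" "Y \<in> C w" "S = f Y" by blast
      have "tau X v \<le> tau Y w + c {v, w}"
      proof (cases "Y \<in> C v")
        case True
        have "f X = f Y" using XY(2,4) by simp
        then have "X = Y" using inj_onD[OF f_inj[OF vw(1)]] XY(1) True by blast
        then show ?thesis using lip[OF e not_both(2)[OF vw(1)] not_both(2)[OF vw(2)]] XY by blast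
      next
        case False
        \<comment> \<open>Different parts stand at the two ends, and \<open>Y\<close> has loaded the
          reverse arc since \<open>tau Y w\<close>.\<close>
        have e': "{w, v} \<in> E" using e by (simp add: insert_commute)
        have "t - tau Y w \<le> c {w, v}"
          using l_lo[OF e' not_both(2)[OF vw(2)] XY(3) False] l_cap[OF e'] by simp
        then show ?thesis
          using tau[OF not_both(2)[OF vw(1)] XY(1)] by (simp add: insert_commute)
      qed
      then show ?thesis using XY tau'_f vw by metis
    qed
    show "l v w \<le> (\<Sum>S\<in>f ` C v - {X'}. t - tau' S v) + max 0 (tau' X' w - tau' X' v) \<or>
        opt (insert v (insert w (\<Union>(f ` C v)))) - (\<Sum>S\<in>f ` C v. opt S) + l v w
          \<le> c {v, w} + (if f ` C v = {X'} then 2 * t - D * t else 5 * t - 2 * (D * t))"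
      if e: "{v, w} \<in> E" and vw: "v \<notin> cl'" "w \<notin> cl'" and X': "f ` C w = {X'}" "X' \<in> f ` C v" for v w X'
    proof -
      from X'(1) obtain Y where Y: "Y \<in> C w" "X' = f Y" by blast
      have Cw: "C w = {Y}" using X'(1) Y f_single[OF vw(2) Y(1)] by simp
      from X'(2) obtain Z where Z: "Z \<in> C v" "X' = f Z" by blast
      note ncl = not_both(2)[OF vw(1)] not_both(2)[OF vw(2)]
      have vV: "v \<in> V" "w \<in> V" using edge_in_V e by simp_all
      show ?thesis
      proof (cases "Y \<in> C v")
        case True
        have iff: "f ` C v = {X'} \<longleftrightarrow> C v = {Y}"
          using f_single[OF vw(1) True] Y(2) by auto
        have "opt ({v, w} \<union> \<Union>(f ` C v)) - (\<Sum>S\<in>f ` C v. opt S)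
            \<le> opt ({v, w} \<union> \<Union>(C v)) - (\<Sum>S\<in>C v. opt S)"
          using merge_le[of "{v, w}" "C v"] vV C_V'(2)[OF True] not_both(1)[OF vw(1)] by simp
        moreover have "{v, w} \<union> M = insert v (insert w M)" for M :: "'a set" by simp
        ultimately have le: "opt (insert v (insert w (\<Union>(f ` C v)))) - (\<Sum>S\<in>f ` C v. opt S)
            \<le> opt (insert v (insert w (\<Union>(C v)))) - (\<Sum>S\<in>C v. opt S)" by metis
        have "(\<Sum>S\<in>f ` C v - {X'}. t - tau' S v) = (\<Sum>S\<in>C v - {Y}. t - tau S v)"
          using sum_f[OF vw(1), of "{Y}"] True Y(2) by simp
        moreover have "tau' X' w = tau Y w" "tau' X' v = tau Y v"
          using tau'_f vw Y True by simp_all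
        ultimately show ?thesis
          using common[OF e ncl Cw True] le unfolding iff by linarith
      next
        case False
        \<comment> \<open>The ends of the arc were reached by different parts of the merged
          component; from here on the second alternative of \<open>common\<close> is shown.\<close>
        then have YZ: "{Y, Z} = {A, B}" "Y \<noteq> Z"
          using f_eq[of Y Z] Y Z C_P[OF Y(1)] C_P[OF Z(1)] by auto
        then have J: "X' = J" "Y \<union> Z = J" "opt J = opt Y + opt Z + D * t"
          using Y(2) f_A tp'(2) by (auto simp: doubleton_eq_iff J_def)
        have YV: "Y \<subseteq> V" and CvV: "\<Union>(C v) \<subseteq> V" using C_sub_V Y(1) C_sub_V[of _ v] by blast+
        have fC: "f ` C v = insert J (C v - {Z})"
        proof -
          have "f S = S" if "S \<in> C v - {Z}" for S
          proof -
            have "S \<noteq> A" "S \<noteq> B" using that False YZ by (auto simp: doubleton_eq_iff)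
            then show ?thesis by (rule f_other)
          qed
          then have "f ` (C v - {Z}) = C v - {Z}" by force
          moreover have "f ` C v = insert (f Z) (f ` (C v - {Z}))" using Z(1) by blast
          ultimately show ?thesis using Z(2) J(1) by simp
        qed
        have JC: "J \<notin> C v" using JP C_P by blast
        have "(\<Sum>S\<in>f ` C v. opt S) = opt J + (\<Sum>S\<in>C v - {Z}. opt S)"
          unfolding fC using fin_C[of v] JC by (subst sum.insert) auto
        then have sum: "(\<Sum>S\<in>f ` C v. opt S) = (\<Sum>S\<in>C v. opt S) + opt Y + D * t"
          using sum.remove[OF fin_C Z(1), of opt] J(3) by simp
        have U: "insert v (insert w (\<Union>(f ` C v))) = insert v (insert w (\<Union>(C v))) \<union> insert w Y"
          unfolding fC J(2)[symmetric] using Z(1) by blast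
        \<comment> \<open>The tree at \<open>v\<close> is extended along the edge and joined with
          the tree of \<open>Y\<close> at \<open>w\<close>; the link inside \<open>J\<close> is then
          deducted.\<close>
        have "opt (insert v (insert w (\<Union>(C v))) \<union> insert w Y)
            \<le> opt (insert v (insert w (\<Union>(C v)))) + opt (insert w Y)"
          using vV YV CvV by (intro opt_Un) auto
        also have "\<dots> \<le> opt (insert v (\<Union>(C v))) + c {v, w} + opt (insert w Y)"
          using opt_insert_edge[OF e CvV] by simp
        finally have le: "opt (insert v (insert w (\<Union>(f ` C v)))) - (\<Sum>S\<in>f ` C v. opt S)
            \<le> opt (insert v (\<Union>(C v))) - (\<Sum>S\<in>C v. opt S) + c {v, w} + Phi Y w - D * t"
          unfolding U sum Phi_def by simp
        have PhiY: "Phi Y w \<le> t" using Phi_one[OF ncl(2) Cw] tau[OF ncl(2) Y(1)] by simp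
        have "opt (insert v (insert w (\<Union>(f ` C v)))) - (\<Sum>S\<in>f ` C v. opt S) + l v w
          \<le> c {v, w} + (if f ` C v = {X'} then 2 * t - D * t else 5 * t - 2 * (D * t))"
        \<comment> \<open>The tree at \<open>v\<close> and the load cost at most \<open>t\<close>
          for one component and \<open>3 * t - D * t / 2\<close> for two;
          \<open>Phi Y w - D * t\<close> adds at most \<open>t - D * t\<close>. In the second case
          the total is at most \<open>5 * t - 2 * (D * t)\<close> since
          \<open>D \<le> 2\<close>.\<close>
        proof (cases "C v = {Z}")
          case True
          have "f ` C v = {X'}" using True Z(2) by simp
          moreover have "opt (insert v (\<Union>(C v))) - (\<Sum>S\<in>C v. opt S) \<le> tau Z v"
            using Phi_one[OF ncl(1) True] True by (simp add: Phi_def)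
          moreover have "l v w \<le> t - tau Z v" using l_up[OF e ncl(1)] True by simp
          ultimately show ?thesis using le PhiY by simp
        next
          case False
          then obtain T where T: "T \<in> C v" "T \<noteq> Z" using Z(1) by blast
          then have CT: "C v = {Z, T}" using two[OF Z(1) T(1)] Z(1) by blast
          have ne: "f ` C v \<noteq> {X'}"
          proof
            assume "f ` C v = {X'}"
            then have "f ` C v = {f Z}" using Z(2) by simp
            then have "C v = {Z}" by (rule f_single[OF vw(1) Z(1)])
            then show False using T by blast
          qed
          have "opt (insert v (\<Union>(C v))) - (\<Sum>S\<in>C v. opt S) = Psi Z T v"
            using CT T(2) by (simp add: Psi_def)
          moreover have "l v w \<le> 2 * t - tau Z v - tau T v" using l_up[OF e ncl(1)] CT T(2) by simp
          moreover have "Psi Z T v \<le> tau Z v + tau T v + max (tau Z v) (tau T v) - del Z T / 2"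
            using Psi_two[OF ncl(1) Z(1) T(1)] T(2) by simp
          moreover have "max (tau Z v) (tau T v) \<le> t"
            using tau[OF ncl(1) Z(1)] tau[OF ncl(1) T(1)] by simp
          moreover have "D * t \<le> del Z T" using del_Dt[OF C_P[OF Z(1)] C_P[OF T(1)]] T(2) by simp
          ultimately have "opt (insert v (insert w (\<Union>(f ` C v)))) - (\<Sum>S\<in>f ` C v. opt S) + l v w
            \<le> c {v, w} + (5 * t - 2 * (D * t))"
            using le PhiY Dt(2) by linarith
          then show ?thesis using ne by simp
        qed
        then show ?thesis by (rule disjI2)
      qed
    qed
  qed
  then show ?thesis by (simp add: tau'_def cl'_def J_def)
qed

end

section \<open>The integrality gap\<close>

context growth_state
begin

text \<open>Double counting: a component without \<open>r\<close> has reached a set of vertices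
  whose cut is constrained in the relaxation, and \<open>(v, w)\<close> leaves exactly the sets of
  the components in \<open>C v - C w\<close>.\<close>

lemma cut_mass:
  assumes r: "r \<in> R" and x: "BCR_feasible V E R r x"
  shows "real (card P) - 1 \<le> (\<Sum>(v, w)\<in>bidirected E. real (card (C v - C w)) * x (v, w))"
proof -
  have x_cut: "1 \<le> (\<Sum>a\<in>out_cut E S. x a)" if "S \<subseteq> V - {r}" "S \<inter> R \<noteq> {}" for S
    using x that by (simp add: BCR_feasible_def)
  have x_nonneg: "0 \<le> x a" if "a \<in> bidirected E" for a
    using x that by (simp add: BCR_feasible_def)
  have fin: "finite (bidirected E)"
    using finite_subset[OF bidirected_subset[OF graph(1)]] graph(3) by simp
  define U where "U S = {v. S \<in> C v}" for S
  have mass_nonneg: "0 \<le> (\<Sum>a\<in>out_cut E (U S). x a)" for S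
    using x_nonneg by (intro sum_nonneg) (auto simp: out_cut_def)
  have mass: "1 \<le> (\<Sum>a\<in>out_cut E (U S). x a)" if S: "S \<in> P" "r \<notin> S" for S
  proof (rule x_cut)
    show "U S \<subseteq> V - {r}" using C_V own_only[OF r] S(2) by (auto simp: U_def)
    have "S \<noteq> {}" "S \<subseteq> R" using part S(1) by (auto simp: partition_def)
    moreover have "S \<subseteq> U S" using own[OF S(1)] by (auto simp: U_def)
    ultimately show "U S \<inter> R \<noteq> {}" by blast
  qed
  obtain Z where Z: "Z \<in> P" "r \<in> Z" using r part by (auto simp: partition_def)
  then have unique: "r \<notin> S" if "S \<in> P - {Z}" for S
    using that part unfolding partition_def by blast
  have "real (card P) - 1 = (\<Sum>S\<in>P - {Z}. 1)"
    using card.remove[OF fin_P Z(1)] by simp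
  also have "\<dots> \<le> (\<Sum>S\<in>P - {Z}. \<Sum>a\<in>out_cut E (U S). x a)"
    using mass unique by (intro sum_mono) auto
  also have "\<dots> \<le> (\<Sum>S\<in>P. \<Sum>a\<in>out_cut E (U S). x a)"
    using fin_P mass_nonneg by (intro sum_mono2) auto
  also have "\<dots> = (\<Sum>S\<in>P. \<Sum>a\<in>bidirected E. if a \<in> out_cut E (U S) then x a else 0)"
  proof (rule sum.cong[OF refl])
    fix S
    have "out_cut E (U S) = bidirected E \<inter> out_cut E (U S)" by (auto simp: out_cut_def)
    then show "(\<Sum>a\<in>out_cut E (U S). x a) =
        (\<Sum>a\<in>bidirected E. if a \<in> out_cut E (U S) then x a else 0)"
      using sum.inter_restrict[OF fin, of x "out_cut E (U S)"] by simp
  qed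
  also have "\<dots> = (\<Sum>a\<in>bidirected E. \<Sum>S\<in>P. if a \<in> out_cut E (U S) then x a else 0)"
    by (rule sum.swap)
  also have "\<dots> = (\<Sum>(v, w)\<in>bidirected E. real (card (C v - C w)) * x (v, w))"
  proof (rule sum.cong[OF refl], clarify)
    fix v w assume vw: "(v, w) \<in> bidirected E"
    have "(\<Sum>S\<in>P. if (v, w) \<in> out_cut E (U S) then x (v, w) else 0)
        = (\<Sum>S\<in>P. if S \<in> C v - C w then x (v, w) else 0)"
      using vw by (intro sum.cong) (auto simp: out_cut_def U_def)
    also have "\<dots> = (\<Sum>S\<in>P \<inter> (C v - C w). x (v, w))"
      by (rule sum.inter_restrict[OF fin_P, symmetric])
    also have "P \<inter> (C v - C w) = C v - C w" using C_P by auto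
    finally show "(\<Sum>S\<in>P. if (v, w) \<in> out_cut E (U S) then x (v, w) else 0)
        = real (card (C v - C w)) * x (v, w)" by simp
  qed
  finally show ?thesis .
qed

end

section \<open>Remaining dual growth against residual arc costs\<close>

context steiner
begin

text \<open>The left side is the dual value still to be grown: a later merger at time
  \<open>t'\<close> adds \<open>D * t'\<close> to the optima of the components, so it is the sum of
  \<open>t' - t\<close> over the \<open>card P - 1\<close> mergers to come.\<close>

lemma residual_bound:
  assumes r: "r \<in> R" and x: "BCR_feasible V E R r x"
    and "growth_state V E c R D t P C l tau cl"
  shows "(opt R - (\<Sum>S\<in>P. opt S)) / D - (real (card P) - 1) * t
    \<le> (\<Sum>(v, w)\<in>bidirected E. (c {v, w} - l v w) * x (v, w))"
  using assms(3)
\<comment> \<open>The sum counts the components missing at each vertex. An arrival lowers it; a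
  merger lowers \<open>card P\<close> without raising it.\<close>
proof (induction "card P + (\<Sum>v\<in>V. card (P - C v))" arbitrary: t P C l tau cl rule: less_induct)
  case less
  interpret growth_state V E c R D t P C l tau cl by fact
  have x_nonneg: "0 \<le> x a" if "a \<in> bidirected E" for a
    using x that by (simp add: BCR_feasible_def)
  have D0: "0 < D" using D by simp
  \<comment> \<open>Passing time does not lower the measure, so an advance is always combined with
    the event that ends it; hence the separate \<open>t'\<close> and \<open>l'\<close>.\<close>
  have event: "(opt R - (\<Sum>S\<in>P. opt S)) / D - (real (card P) - 1) * t'
      \<le> (\<Sum>(v, w)\<in>bidirected E. (c {v, w} - l' v w) * x (v, w))"
    if st: "growth_state V E c R D t' P C l' tau cl"
      and ev: "(\<exists>u p. {u, p} \<in> E \<and> l' u p = c {u, p} \<and> \<not> C u \<subseteq> C p) \<or>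
        (\<exists>A\<in>P. \<exists>B\<in>P. \<exists>a\<in>A. \<exists>b\<in>B. A \<noteq> B \<and> dist {a, b} = D * t')" for t' l'
    using ev
  proof (elim disjE exE conjE bexE)
    fix u p assume up: "{u, p} \<in> E" "l' u p = c {u, p}" "\<not> C u \<subseteq> C p"
    let ?C = "C(p := C p \<union> C u)"
    have p: "p \<in> V" using up(1) edge_in_V by simp
    obtain B where B: "B \<in> C u" "B \<notin> C p" using up(3) by blast
    have "(\<Sum>v\<in>V. card (P - ?C v)) < (\<Sum>v\<in>V. card (P - C v))"
    proof (rule sum_strict_mono_ex1[OF graph(3)])
      show "\<forall>v\<in>V. card (P - ?C v) \<le> card (P - C v)"
        using fin_P by (auto intro!: card_mono)
      have "P - ?C p \<subset> P - C p" using B C_P[OF B(1)] by auto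
      then show "\<exists>v\<in>V. card (P - ?C v) < card (P - C v)"
        using p fin_P psubset_card_mono[of "P - C p" "P - ?C p"] by blast
    qed
    then have "card P + (\<Sum>v\<in>V. card (P - ?C v)) < card P + (\<Sum>v\<in>V. card (P - C v))"
      by simp
    from less.hyps[OF this growth_state.absorb[OF st up]] show ?thesis .
  next
    fix A B a b
    assume AB: "A \<in> P" "B \<in> P" "A \<noteq> B" and ab: "a \<in> A" "b \<in> B" "dist {a, b} = D * t'"
    let ?f = "\<lambda>S. if S = A \<or> S = B then A \<union> B else S" and ?P = "join A B P"
    note merged = growth_state.merge[OF st AB ab]
    have "card (?P - ?f ` C v) \<le> card (P - C v)" for v
    proof (cases "A \<in> C v \<or> B \<in> C v")
      case True
      then have "A \<union> B \<in> ?f ` C v" by force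
      then have "?P - ?f ` C v \<subseteq> P - C v" by (auto simp: join_def)
      then show ?thesis using fin_P by (auto intro: card_mono)
    next
      case False
      have "?P - ?f ` C v \<subseteq> insert (A \<union> B) (P - C v - {A, B})" by (auto simp: join_def)
      then have "card (?P - ?f ` C v) \<le> card (insert (A \<union> B) (P - C v - {A, B}))"
        using fin_P by (intro card_mono) auto
      also have "\<dots> \<le> Suc (card (P - C v - {A, B}))"
        using fin_P by (simp add: card_insert_if)
      also have "\<dots> \<le> Suc (card (P - C v - {A}))"
        using fin_P by (auto intro!: card_mono)
      also have "\<dots> = card (P - C v)"
        using fin_P False AB by (intro card.remove[symmetric]) auto
      finally show ?thesis .
    qed
    then have "(\<Sum>v\<in>V. card (?P - ?f ` C v)) \<le> (\<Sum>v\<in>V. card (P - C v))"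
      by (intro sum_mono)
    moreover note card = card_join[OF part AB]
    ultimately have "card ?P + (\<Sum>v\<in>V. card (?P - ?f ` C v))
        < card P + (\<Sum>v\<in>V. card (P - C v))" by simp
    from less.hyps[OF this merged]
    have "(opt R - (\<Sum>S\<in>?P. opt S)) / D - (real (card ?P) - 1) * t'
      \<le> (\<Sum>(v, w)\<in>bidirected E. (c {v, w} - l' v w) * x (v, w))" .
    moreover have "opt (A \<union> B) = opt A + opt B + D * t'"
      using tight_partition_join(2)[OF tp growth_state.sep[OF st] AB ab] .
    then have "(\<Sum>S\<in>?P. opt S) = (\<Sum>S\<in>P. opt S) + D * t'"
      using sum_join[OF part AB, of opt] by simp
    \<comment> \<open>The quotient drops by \<open>t'\<close> and the number of components by one,
      so a merger preserves the left side.\<close>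
    then have "(opt R - (\<Sum>S\<in>?P. opt S)) / D = (opt R - (\<Sum>S\<in>P. opt S)) / D - t'"
      using D0 by (simp add: field_simps)
    moreover have "real (card P) = real (card ?P) + 1" using card by simp
    ultimately show ?thesis by (simp add: algebra_simps)
  qed
  show ?case
  proof (cases "card P = 1")
    case True
    then obtain S where "P = {S}" by (auto simp: card_1_singleton_iff)
    then have "P = {R}" using part by (auto simp: partition_def)
    moreover have "0 \<le> (\<Sum>(v, w)\<in>bidirected E. (c {v, w} - l v w) * x (v, w))"
      using x_nonneg l_cap by (intro sum_nonneg) (auto simp: bidirected_def)
    ultimately show ?thesis by simp
  next
    case False
    show ?thesis
    proof (cases "\<exists>u p. {u, p} \<in> E \<and> l u p = c {u, p} \<and> \<not> C u \<subseteq> C p")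
      case True
      then show ?thesis using event[OF less.prems] by blast
    next
      case stuck: False
      obtain A B a b where AB: "A \<in> P" "B \<in> P" "A \<noteq> B" "a \<in> A" "b \<in> B"
        "separated (dist {a, b}) P" using closest_pair[OF part False] by metis
      define rate where "rate v w = real (card (C v - C w))" for v w
      define arcs where "arcs = {(v, w) \<in> bidirected E. \<not> C v \<subseteq> C w}"
      define slack where "slack = (\<lambda>(v, w). (c {v, w} - l v w) / rate v w)"
      \<comment> \<open>The waiting time until a merger is due or an arc is full; it is zero if a
        merger is already due.\<close>
      define s where "s = Min (insert (dist {a, b} / D - t) (slack ` arcs))"
      have "finite arcs"
        using finite_subset[OF bidirected_subset[OF graph(1)]] graph(3)
        unfolding arcs_def by (auto intro: finite_subset[of _ "bidirected E"])
      then have fin: "finite (insert (dist {a, b} / D - t) (slack ` arcs))" by simp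
      have rate_pos: "0 < rate v w" if "\<not> C v \<subseteq> C w" for v w
        using that fin_C[of v] by (auto simp: rate_def card_gt_0_iff)
      have rate_0: "rate v w = 0" if "C v \<subseteq> C w" for v w
        using that by (simp add: rate_def Diff_eq_empty_iff[THEN iffD2])
      have s_cases: "s = dist {a, b} / D - t \<or> (\<exists>q\<in>arcs. s = slack q)"
        using Min_in[OF fin] unfolding s_def by blast
      have s_le: "s \<le> dist {a, b} / D - t" "\<And>q. q \<in> arcs \<Longrightarrow> s \<le> slack q"
        unfolding s_def using fin by (auto intro: Min_le)
      have "D * t \<le> dist {a, b}" using sep AB unfolding separated_def by blast
      then have "0 \<le> dist {a, b} / D - t" using D0 by (simp add: field_simps)
      moreover have "0 \<le> slack q" if "q \<in> arcs" for q
        using that l_cap rate_pos by (force simp: slack_def arcs_def bidirected_def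
            intro!: divide_nonneg_pos)
      ultimately have s0: "0 \<le> s" using s_cases by auto
      have cap: "l v w + s * real (card (C v - C w)) \<le> c {v, w}" if e: "{v, w} \<in> E" for v w
      proof (cases "C v \<subseteq> C w")
        case True
        then show ?thesis using l_cap[OF e] rate_0 by (simp add: rate_def)
      next
        case False
        then have "(v, w) \<in> arcs" using e by (simp add: arcs_def bidirected_def)
        from s_le(2)[OF this] show ?thesis
          using rate_pos[OF False] by (simp add: slack_def rate_def field_simps)
      qed
      have "D * (t + s) \<le> dist {a, b}" using s_le(1) D0 by (simp add: field_simps)
      then have "separated (D * (t + s)) P"
        using AB(6) unfolding separated_def by (meson order_trans)
      note st = advance[OF s0 this cap]
      let ?l = "\<lambda>v w. l v w + s * real (card (C v - C w))"
      have ev: "(\<exists>u p. {u, p} \<in> E \<and> ?l u p = c {u, p} \<and> \<not> C u \<subseteq> C p) \<or>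
        (\<exists>A\<in>P. \<exists>B\<in>P. \<exists>a\<in>A. \<exists>b\<in>B. A \<noteq> B \<and> dist {a, b} = D * (t + s))"
        using s_cases
      proof
        assume "s = dist {a, b} / D - t"
        then have "dist {a, b} = D * (t + s)" using D0 by (simp add: field_simps)
        then show ?thesis using AB by blast
      next
        assume "\<exists>q\<in>arcs. s = slack q"
        then obtain v w where vw: "(v, w) \<in> arcs" "s = slack (v, w)" by (metis surj_pair)
        then have "\<not> C v \<subseteq> C w" "{v, w} \<in> E" by (auto simp: arcs_def bidirected_def)
        moreover from this have "?l v w = c {v, w}"
          using vw(2) rate_pos[of v w] by (simp add: slack_def rate_def)
        ultimately show ?thesis by blast
      qed
      \<comment> \<open>By \<open>cut_mass\<close> the residual cost falls by at least as much as
        the left side rises from time \<open>t + s\<close> back to \<open>t\<close>.\<close>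
      have "(real (card P) - 1) * s
          \<le> s * (\<Sum>(v, w)\<in>bidirected E. real (card (C v - C w)) * x (v, w))"
        using mult_left_mono[OF cut_mass[OF r x] s0] by (simp add: mult.commute)
      moreover have "(\<Sum>(v, w)\<in>bidirected E. (c {v, w} - ?l v w) * x (v, w))
          = (\<Sum>(v, w)\<in>bidirected E. (c {v, w} - l v w) * x (v, w))
          - s * (\<Sum>(v, w)\<in>bidirected E. real (card (C v - C w)) * x (v, w))"
        by (simp add: sum_distrib_left sum_subtractf[symmetric] case_prod_unfold algebra_simps)
      ultimately show ?thesis using event[OF st ev] by (simp add: algebra_simps)
    qed
  qed
qed

lemma growth_state_initial:
  assumes mst: "MST_optimal V E c R" and D: "12 / 7 < D" "D \<le> 2"
  shows "growth_state V E c R D 0 ((\<lambda>s. {s}) ` R) (\<lambda>v. if v \<in> R then {{v}} else {})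
    (\<lambda>_ _. 0) (\<lambda>_ _. 0) {}"
proof
  show "12 / 7 < D" "D \<le> 2" by (fact D)+
  show "tight_partition ((\<lambda>s. {s}) ` R)" by (rule tight_partition_singletons[OF mst])
  have "0 \<le> dist {x, y}" if "x \<in> R" "y \<in> R" for x y
    using opt_le_dist[of x y] opt_nonneg[of "{x, y}"] that graph(5) by force
  then show "separated (D * 0) ((\<lambda>s. {s}) ` R)" by (auto simp: separated_def)
  show "v \<in> V" if "S \<in> (if v \<in> R then {{v}} else {})" for S v
    using that graph(5) by (auto split: if_splits)
  show "Phi A v \<le> 0" if "(if v \<in> R then {{v}} else {}) = {A}" for v A
    using that by (auto simp: Phi_def split: if_splits)
qed (auto simp: c_pos less_imp_le split: if_splits)

end

theorem theorem1p3:
  fixes V :: "'a set" and E :: "'a set set" and c :: "'a set \<Rightarrow> real"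
    and R :: "'a set" and r :: 'a
  assumes "steiner_instance V E c R"
    and "MST_optimal V E c R"
    and "r \<in> R"
  shows "OPT V E c R \<le> 12 / 7 * BCR V E c R r"
proof -
  interpret steiner V E c R by unfold_locales (fact assms(1))
  have bound: "OPT V E c R \<le> 12 / 7 * BCR_cost E c x" if x: "BCR_feasible V E R r x" for x
  proof (rule ccontr)
    assume "\<not> ?thesis"
    then have less: "12 / 7 * BCR_cost E c x < OPT V E c R" by simp
    have *: "OPT V E c R \<le> D * BCR_cost E c x" if D: "12 / 7 < D" "D \<le> 2" for D
    proof -
      have "(\<Sum>S\<in>(\<lambda>s. {s}) ` R. opt S) = 0" using graph(5) by (intro sum.neutral) auto
      \<comment> \<open>At time zero there are no loads, so the residual cost is the full cost of
        \<open>x\<close>.\<close>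
      then have "opt R / D \<le> BCR_cost E c x"
        using residual_bound[OF assms(3) x growth_state_initial[OF assms(2) D]]
        by (simp add: BCR_cost_def)
      then show ?thesis using OPT_le_opt D by (simp add: field_simps)
    qed
    have "0 \<le> BCR_cost E c x"
      unfolding BCR_cost_def using x c_pos
      by (intro sum_nonneg) (auto simp: BCR_feasible_def bidirected_def less_imp_le)
    \<comment> \<open>The value 2 is admissible for \<open>D\<close>, so cost zero would force a
      nonpositive \<open>OPT\<close>, against \<open>less\<close>.\<close>
    moreover have "BCR_cost E c x \<noteq> 0" using less *[of 2] by auto
    ultimately have pos: "0 < BCR_cost E c x" by simp
    \<comment> \<open>The midpoint between \<open>12 / 7\<close> and the assumed ratio, capped at 2,
      lies strictly between both, which contradicts the bound for this \<open>D\<close>.\<close>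
    define D where "D = min 2 ((12 / 7 + OPT V E c R / BCR_cost E c x) / 2)"
    have "12 / 7 < OPT V E c R / BCR_cost E c x" using less pos by (simp add: field_simps)
    then have D: "12 / 7 < D" "D \<le> 2" "D < OPT V E c R / BCR_cost E c x"
      by (auto simp: D_def min_def)
    then show False using *[of D] pos by (simp add: field_simps)
  qed
  have "OPT V E c R * 7 / 12 \<le> BCR V E c R r"
    unfolding BCR_def using BCR_set(2)[OF assms(1,3)] bound by (intro cInf_greatest) force+
  then show ?thesis by simp
qed

end
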